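(* If $W\in\mathcal R(\mathbb T)$, then $$\|W\|_\mu^2=\mathbf T(W).$$
   Context: $\mathbb T=\mathbb R/2\pi\mathbb Z$ with measure $d\mu=dx/2\pi$. A bounded operator $W$ on $L^2(\mathbb T,\mu)$ has matrix $(W_{j,k})_{j,k\in\mathbb Z}$: $W\sum_kf_ke^{ikx}=\sum_{j,k}W_{j,k}f_ke^{ijx}$. $W\in\mathcal{DT}(\mathbb T)$ (diagonal type) means $c_k=\sup_j|W_{j+k,j}|<\infty$ for all $k\in\mathbb Z$ and $\|W\|_{\mathcal{DT}}:=\sum_{k\in\mathbb Z}c_k<\infty$. $W$ is regular ($W\in\mathcal R(\mathbb T)$) if $W\in\mathcal{DT}(\mathbb T)$ and for all $m,n\in\mathbb Z$ the limit $\omega_{m,n}=\lim_{\#I\to\infty}\frac1{\#I}\sum_{j\in\mathbb Z,\,l\in I}W_{l+m,j}\overline{W_{l,j+n}}$ exists, where $I\subset\mathbb Z$ ranges over finite intervals of consecutive integers (limit over all such intervals, irrespective of position, as the number of elements $\#I\to\infty$). $\mu$-norm: for a bounded operator $W$ on $L^2(\mathbb T,\mu)$, $\|W\|_\mu^2=\inf_\chi\sum_{j=1}^K\mu(Y_j)\|W\pi_{Y_j}\|^2$, where the infimum is over finite measurable partitions $\chi=\{Y_1,\dots,Y_K\}$ of $\mathbb T$ (modulo null sets), $\pi_Y$ is multiplication by the indicator $\mathbf 1_Y$, and $\|\cdot\|$ is the operator norm. Average trace: for $W\in\mathcal{DT}(\mathbb T)$, $\mathbf T(W)=\limsup_{\#I\to\infty}\frac1{\#I}\sum_{j\in\mathbb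 Z,\,l\in I}|W_{l,j}|^2$, over finite integer intervals $I$. *)

theory Defs
  imports "HOL-Analysis.Analysis"
begin

text \<open>
  The circle \<open>\<real>/2\<pi>\<int>\<close> is represented by its fundamental domain \<open>[0, 2\<pi>)\<close>, with
  \<open>d\<mu> = dx/2\<pi>\<close>.
\<close>

definition torus :: "real measure" where
  "torus = density (restrict_space lborel {0..<2*pi}) (\<lambda>_. ennreal (1 / (2*pi)))"

text \<open>
  Elements of \<open>L\<^sup>2(\<mu>)\<close> are handled through representatives: functions, understood up to
  almost-everywhere equality.
\<close>

definition L2_torus :: "(real \<Rightarrow> complex) set" where
  "L2_torus = {f \<in> borel_measurable torus. integrable torus (\<lambda>x. (cmod (f x))\<^sup>2)}"

definition L2_norm :: "(real \<Rightarrow> complex) \<Rightarrow> real" where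
  "L2_norm f = sqrt (LINT x|torus. (cmod (f x))\<^sup>2)"

type_synonym operator = "(real \<Rightarrow> complex) \<Rightarrow> (real \<Rightarrow> complex)"

definition bounded_operator :: "operator \<Rightarrow> bool" where
  "bounded_operator W \<longleftrightarrow>
     (\<forall>f\<in>L2_torus. W f \<in> L2_torus) \<and>
     (\<forall>f\<in>L2_torus. \<forall>g\<in>L2_torus.
        (AE x in torus. f x = g x) \<longrightarrow> (AE x in torus. W f x = W g x)) \<and>
     (\<forall>f\<in>L2_torus. \<forall>g\<in>L2_torus.
        AE x in torus. W (\<lambda>y. f y + g y) x = W f x + W g x) \<and>
     (\<forall>f\<in>L2_torus. \<forall>c::complex. AE x in torus. W (\<lambda>y. c * f y) x = c * W f x) \<and>
     (\<exists>C::real. \<forall>f\<in>L2_torus. L2_norm (W f) \<le> C * L2_norm f)"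

definition op_norm :: "operator \<Rightarrow> real" where
  "op_norm W = Sup {L2_norm (W f) | f. f \<in> L2_torus \<and> L2_norm f \<le> 1}"

definition fourier_mode :: "int \<Rightarrow> real \<Rightarrow> complex" where
  "fourier_mode k x = exp (\<i> * of_int k * of_real x)"

definition fourier_coeff :: "(real \<Rightarrow> complex) \<Rightarrow> int \<Rightarrow> complex" where
  "fourier_coeff f j = (LINT x|torus. cnj (fourier_mode j x) * f x)"

text \<open>
  \<open>W e\<^sub>k = \<Sum>\<^sub>j W\<^sub>j\<^sub>k e\<^sub>j\<close> in \<open>L\<^sup>2\<close>, where \<open>e\<^sub>k(x) = exp(i k x)\<close>: the entry \<open>W\<^sub>j\<^sub>k\<close> is
  the \<open>j\<close>-th Fourier coefficient of \<open>W e\<^sub>k\<close>.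
\<close>

definition mat_entry :: "operator \<Rightarrow> int \<Rightarrow> int \<Rightarrow> complex" where
  "mat_entry W j k = fourier_coeff (W (fourier_mode k)) j"

definition diag_sup :: "operator \<Rightarrow> int \<Rightarrow> real" where
  "diag_sup W k = (SUP j. cmod (mat_entry W (j + k) j))"

definition diagonal_type :: "operator set" where
  "diagonal_type = {W. bounded_operator W \<and>
     (\<forall>k. bdd_above (range (\<lambda>j. cmod (mat_entry W (j + k) j)))) \<and>
     diag_sup W summable_on UNIV}"

text \<open>
  The filter for limits over finite intervals \<open>I\<close> of integers as the number of elements of
  \<open>I\<close> tends to infinity, uniformly in the position of \<open>I\<close>.
\<close>

definition long_intervals :: "int set filter" where
  "long_intervals = inf (filtercomap card at_top) (principal {I. \<exists>a b. I = {a..b}})"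

lemma eventually_long_intervals:
  "eventually P long_intervals \<longleftrightarrow> (\<exists>N. \<forall>a b. card {a..b} \<ge> N \<longrightarrow> P {a..b})"
proof
  assume "eventually P long_intervals"
  then obtain Q N where "\<forall>n\<ge>N. Q n" "\<forall>I. Q (card I) \<longrightarrow> (\<exists>a b. I = {a..b}) \<longrightarrow> P I"
    unfolding long_intervals_def eventually_inf_principal eventually_filtercomap
      eventually_at_top_linorder by auto
  then show "\<exists>N. \<forall>a b. card {a..b} \<ge> N \<longrightarrow> P {a..b}" by blast
next
  assume "\<exists>N. \<forall>a b. card {a..b} \<ge> N \<longrightarrow> P {a..b}"
  then obtain N where "\<forall>a b. card {a..b} \<ge> N \<longrightarrow> P {a..b}" by blast
  then show "eventually P long_intervals"
    unfolding long_intervals_def eventually_inf_principal eventually_filtercomap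
      eventually_at_top_linorder
    by (intro exI[of _ "\<lambda>n. N \<le> n"] conjI exI[of _ N]) auto
qed

definition correlation_mean :: "operator \<Rightarrow> int \<Rightarrow> int \<Rightarrow> int set \<Rightarrow> complex" where
  "correlation_mean W m n I =
     (1 / of_nat (card I)) *
     (\<Sum>\<^sub>\<infinity>(j, l)\<in>UNIV \<times> I. mat_entry W (l + m) j * cnj (mat_entry W l (j + n)))"

definition regular_operators :: "operator set" where
  "regular_operators = {W \<in> diagonal_type.
     \<forall>m n. \<exists>\<omega>. (correlation_mean W m n \<longlongrightarrow> \<omega>) long_intervals}"

definition cutoff :: "real set \<Rightarrow> operator" where
  "cutoff Y f = (\<lambda>x. indicator Y x * f x)"

text \<open>
  A finite partition modulo null sets: blocks overlap in null sets and cover up to a null set.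
  Null or empty blocks are allowed; they contribute nothing to the sum below.
\<close>

definition torus_partition :: "nat \<Rightarrow> (nat \<Rightarrow> real set) \<Rightarrow> bool" where
  "torus_partition K Y \<longleftrightarrow>
     (\<forall>i\<in>{1..K}. Y i \<in> sets torus) \<and>
     (\<forall>i\<in>{1..K}. \<forall>j\<in>{1..K}. i \<noteq> j \<longrightarrow> Y i \<inter> Y j \<in> null_sets torus) \<and>
     space torus - (\<Union>i\<in>{1..K}. Y i) \<in> null_sets torus"

definition mu_norm :: "operator \<Rightarrow> real" where
  "mu_norm W = sqrt (Inf {(\<Sum>i=1..K. measure torus (Y i) * (op_norm (W \<circ> cutoff (Y i)))\<^sup>2)
     | K Y. torus_partition K Y})"

text \<open>
  The limsup is taken in the extended reals, where it always exists; for operators of diagonal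
  type the sums converge and the averages are bounded.
\<close>

definition average_trace :: "operator \<Rightarrow> ereal" where
  "average_trace W = Limsup long_intervals (\<lambda>I. ereal (
     (1 / real (card I)) * (\<Sum>\<^sub>\<infinity>(j, l)\<in>UNIV \<times> I. (cmod (mat_entry W l j))\<^sup>2)))"

end

theory Submission
  imports Defs
begin

text \<open>
  Let \<open>H\<^sub>l(x) = \<Sum>\<^sub>j W\<^sub>l\<^sub>j e\<^sub>-\<^sub>j(x)\<close> be the function whose Fourier coefficients are,
  in reversed order, the entries of the \<open>l\<close>-th row of the matrix. The rows decay like the summable sequence \<open>c\<close> of diagonal suprema,
  so \<open>H\<^sub>l\<close> is continuous, and the \<open>l\<close>-th coefficient of \<open>W f\<close> is \<open>\<integral> H\<^sub>l f\<close>. Consequently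
  \<open>\<Sum>\<^sub>j |W\<^sub>l\<^sub>j|\<^sup>2 = \<integral> |H\<^sub>l|\<^sup>2\<close>, and the average trace is the mean over the rows \<open>l\<close> of
  \<open>\<integral> |H\<^sub>l|\<^sup>2\<close>; regularity makes this mean converge to a number \<open>\<tau>\<close>. Both inequalities compare
  \<open>\<parallel>W \<pi>\<^sub>Y\<parallel>\<^sup>2\<close> with means of \<open>|H\<^sub>l|\<^sup>2\<close> over \<open>Y\<close>.

  Lower bound. The squared entries of \<open>W \<pi>\<^sub>Y\<close> sum to \<open>\<integral>\<^sub>Y |H\<^sub>l|\<^sup>2\<close> along a row and to
  at most \<open>\<mu>(Y) \<parallel>W \<pi>\<^sub>Y\<parallel>\<^sup>2\<close> along a column. They are dominated by a summable function of
  the distance from the diagonal, so over a long interval of indices the row sums and the column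
  sums differ by a boundary term that is negligible against the length
  (\<open>row_average_localized_le\<close>). Summing over the blocks of a partition gives
  \<open>\<tau> \<le> \<Sum>\<^sub>i \<mu>(Y\<^sub>i) \<parallel>W \<pi>\<^sub>Y\<^sub>i\<parallel>\<^sup>2\<close>.

  Upper bound. If \<open>f\<close> lives on a short arc near \<open>y\<close>, multiplication of \<open>f\<close> by a mode is almost
  multiplication by the value of the mode at \<open>y\<close>. On the Fourier side this says that shifting the
  coefficients of \<open>f\<close> only changes their phase. Hence the \<open>l\<close>-th coefficient of \<open>W f\<close> is about
  \<open>H\<^sub>l(y)\<close> times the \<open>l\<close>-th coefficient of \<open>f\<close> up to a phase, and since the moduli of the latter
  hardly vary over \<open>N\<close> consecutive indices, \<open>|H\<^sub>l(y)|\<^sup>2\<close> may be averaged over such a window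
  (\<open>local_upper_bound\<close>). The Fourier coefficients of \<open>|H\<^sub>l|\<^sup>2\<close> are the autocorrelations of the
  \<open>l\<close>-th row, whose averages over windows converge by regularity, so the averages of
  \<open>|H\<^sub>l(y)|\<^sup>2\<close> are, uniformly in \<open>y\<close>, close to a trigonometric polynomial with constant term
  \<open>\<tau>\<close> (\<open>row_average_uniform_le\<close>). Its mean over sufficiently many equidistant points is exactly \<open>\<tau>\<close>,
  which bounds the sum for the partition into equal arcs.

  The two bounds rest on Parseval's identity. Its completeness half is derived from the Basel series:
  the latter says that the sawtooth functions have no defect in Bessel's inequality, differences
  of sawtooths are indicators of arcs, and these generate everything.
\<close>

section \<open>Square-integrable functions on the circle\<close>

lemma space_torus [simp]: "space torus = {0..<2*pi}"
  by (simp add: torus_def space_restrict_space)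

lemma sets_torus: "sets torus = sets (restrict_space borel {0..<2*pi})"
  by (simp add: torus_def sets_restrict_space)

lemma borel_measurable_torusI:
  "f \<in> borel_measurable borel \<Longrightarrow> f \<in> borel_measurable torus"
  unfolding measurable_cong_sets[OF sets_torus refl] by (rule measurable_restrict_space1)

lemma in_sets_torusD: "Y \<in> sets torus \<Longrightarrow> Y \<in> sets borel \<and> Y \<subseteq> {0..<2*pi}"
  unfolding sets_torus by (subst (asm) sets_restrict_space_iff) auto

lemma in_sets_torusI: "Y \<in> sets borel \<Longrightarrow> Y \<inter> {0..<2*pi} \<in> sets torus"
  unfolding sets_torus sets_restrict_space by auto

lemma has_bochner_integral_torus:
  fixes f :: "real \<Rightarrow> 'b::{banach,second_countable_topology}"
  assumes "f \<in> borel_measurable torus"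
    and "has_bochner_integral lborel (\<lambda>x. indicator {0..<2*pi} x *\<^sub>R f x) s"
  shows "has_bochner_integral torus f ((1 / (2*pi)) *\<^sub>R s)"
proof -
  let ?R = "restrict_space lborel {0..<2*pi}"
  have f: "f \<in> borel_measurable ?R"
    using assms(1) unfolding torus_def by simp
  have "has_bochner_integral ?R f s"
    using assms(2) unfolding has_bochner_integral_iff
    by (subst integrable_restrict_space, simp, subst integral_restrict_space, simp, assumption)
  then have "has_bochner_integral ?R (\<lambda>x. (1 / (2*pi)) *\<^sub>R f x) ((1 / (2*pi)) *\<^sub>R s)"
    by (rule has_bochner_integral_scaleR_right)
  then show ?thesis
    unfolding torus_def by (intro has_bochner_integral_density) (use f in auto)
qed

lemma has_bochner_integral_torus_FTC:
  fixes f F :: "real \<Rightarrow> 'b::euclidean_space"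
  assumes "0 \<le> a" "a \<le> 2*pi"
    and F: "\<And>x. (F has_vector_derivative f x) (at x)" and cont: "continuous_on UNIV f"
  shows "has_bochner_integral torus (\<lambda>x. indicator {..<a} x *\<^sub>R f x) ((1 / (2*pi)) *\<^sub>R (F a - F 0))"
proof (rule has_bochner_integral_torus)
  have [measurable]: "f \<in> borel_measurable borel"
    using cont by (rule borel_measurable_continuous_onI)
  show "(\<lambda>x. indicator {..<a} x *\<^sub>R f x) \<in> borel_measurable torus"
    by (rule borel_measurable_torusI) measurable
  have "has_bochner_integral lborel (\<lambda>x. indicator {0..a} x *\<^sub>R f x) (F a - F 0)"
    by (rule has_bochner_integral_FTC_Icc[OF assms(1) has_vector_derivative_at_within[OF F]
          continuous_on_subset[OF cont subset_UNIV]])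
  moreover have "AE x in lborel. indicator {0..a} x *\<^sub>R f x =
      indicator {0..<2*pi} x *\<^sub>R indicator {..<a} x *\<^sub>R f x"
    using AE_lborel_singleton[of a]
  proof eventually_elim
    case (elim x)
    then show ?case using assms(1,2) by (auto split: split_indicator)
  qed
  ultimately show "has_bochner_integral lborel
      (\<lambda>x. indicator {0..<2*pi} x *\<^sub>R indicator {..<a} x *\<^sub>R f x) (F a - F 0)"
    by (subst (asm) has_bochner_integral_cong_AE) auto
qed

lemma has_bochner_integral_torus_FTC_full:
  fixes f F :: "real \<Rightarrow> 'b::euclidean_space"
  assumes F: "\<And>x. (F has_vector_derivative f x) (at x)" and cont: "continuous_on UNIV f"
  shows "has_bochner_integral torus f ((1 / (2*pi)) *\<^sub>R (F (2*pi) - F 0))"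
proof -
  have "has_bochner_integral torus (\<lambda>x. indicator {..<2*pi} x *\<^sub>R f x)
      ((1 / (2*pi)) *\<^sub>R (F (2*pi) - F 0))"
    by (rule has_bochner_integral_torus_FTC) (use assms in auto)
  then show ?thesis
    by (subst has_bochner_integral_cong[where g="\<lambda>x. indicator {..<2*pi} x *\<^sub>R f x"]) auto
qed

lemma emeasure_torus_Ico:
  assumes "0 \<le> a" "a \<le> b" "b \<le> 2*pi"
  shows "emeasure torus {a..<b} = ennreal ((b - a) / (2*pi))"
proof -
  have s: "{a..<b} \<in> sets torus"
    using in_sets_torusI[of "{a..<b}"] assms by (auto simp: Int_absorb2)
  have "emeasure torus {a..<b} = (\<integral>\<^sup>+x. ennreal (1/(2*pi)) * indicator {a..<b} x \<partial>restrict_space lborel {0..<2*pi})"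
    unfolding torus_def using s by (subst emeasure_density) (auto simp: torus_def)
  also have "\<dots> = ennreal (1/(2*pi)) * emeasure (restrict_space lborel {0..<2*pi}) {a..<b}"
    using s by (subst nn_integral_cmult_indicator) (auto simp: torus_def)
  also have "\<dots> = ennreal (1/(2*pi)) * ennreal (b - a)"
    using assms by (subst emeasure_restrict_space) auto
  also have "\<dots> = ennreal ((b - a) / (2*pi))"
    by (subst ennreal_mult[symmetric]) (use assms in auto)
  finally show ?thesis .
qed

lemma finite_measure_torus: "finite_measure torus"
  by (rule finite_measureI) (use emeasure_torus_Ico[of 0 "2*pi"] in auto)

interpretation torus: finite_measure torus
  by (rule finite_measure_torus)

lemma measure_torus_space [simp]: "measure torus {0..<2*pi} = 1"
  using emeasure_torus_Ico[of 0 "2*pi"] by (simp add: measure_def)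

lemma L2_measurable: "f \<in> L2_torus \<Longrightarrow> f \<in> borel_measurable torus"
  by (simp add: L2_torus_def)

lemma L2_square_integrable: "f \<in> L2_torus \<Longrightarrow> integrable torus (\<lambda>x. (cmod (f x))\<^sup>2)"
  by (simp add: L2_torus_def)

lemma L2I_dominated:
  assumes "f \<in> borel_measurable torus" "integrable torus g"
    and "\<And>x. x \<in> {0..<2*pi} \<Longrightarrow> (cmod (f x))\<^sup>2 \<le> g x"
  shows "f \<in> L2_torus"
  unfolding L2_torus_def
proof safe
  show "integrable torus (\<lambda>x. (cmod (f x))\<^sup>2)"
    by (rule Bochner_Integration.integrable_bound[OF assms(2)])
      (use assms in \<open>auto intro!: AE_I2 order_trans[OF _ abs_ge_self]\<close>)
qed fact

lemma L2I_bounded: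
  assumes "f \<in> borel_measurable torus" "\<And>x. x \<in> {0..<2*pi} \<Longrightarrow> cmod (f x) \<le> B"
  shows "f \<in> L2_torus"
  by (rule L2I_dominated[of f "\<lambda>_. B\<^sup>2"]) (use assms in \<open>auto intro: power_mono\<close>)

lemma cmod_add_sq_le: "(cmod (a + b))\<^sup>2 \<le> 2 * (cmod a)\<^sup>2 + 2 * (cmod b)\<^sup>2"
proof -
  have "(cmod (a + b))\<^sup>2 \<le> (cmod a + cmod b)\<^sup>2"
    by (intro power_mono norm_triangle_ineq) auto
  also have "\<dots> \<le> 2 * (cmod a)\<^sup>2 + 2 * (cmod b)\<^sup>2"
    using zero_le_power2[of "cmod a - cmod b"] by (simp add: power2_eq_square algebra_simps)
  finally show ?thesis .
qed

lemma L2_add: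
  assumes "f \<in> L2_torus" "g \<in> L2_torus"
  shows "(\<lambda>x. f x + g x) \<in> L2_torus"
  by (rule L2I_dominated[of _ "\<lambda>x. 2 * (cmod (f x))\<^sup>2 + 2 * (cmod (g x))\<^sup>2"])
    (use assms in \<open>auto simp: L2_torus_def intro: cmod_add_sq_le\<close>)

lemma L2_mult_bounded:
  assumes "f \<in> L2_torus" "h \<in> borel_measurable torus" "\<And>x. x \<in> {0..<2*pi} \<Longrightarrow> cmod (h x) \<le> B"
  shows "(\<lambda>x. h x * f x) \<in> L2_torus"
proof (rule L2I_dominated[of _ "\<lambda>x. B\<^sup>2 * (cmod (f x))\<^sup>2"])
  show "(cmod (h x * f x))\<^sup>2 \<le> B\<^sup>2 * (cmod (f x))\<^sup>2" if "x \<in> {0..<2*pi}" for x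
    using assms(3)[OF that]
    by (auto simp: norm_mult power_mult_distrib intro!: mult_right_mono power_mono)
qed (use assms in \<open>auto simp: L2_torus_def\<close>)

lemma L2_cmult: "f \<in> L2_torus \<Longrightarrow> (\<lambda>x. c * f x) \<in> L2_torus"
  by (rule L2_mult_bounded[where B="cmod c"]) auto

lemma L2_diff: "f \<in> L2_torus \<Longrightarrow> g \<in> L2_torus \<Longrightarrow> (\<lambda>x. f x - g x) \<in> L2_torus"
  using L2_add[of f "\<lambda>x. (-1) * g x"] L2_cmult[of g "-1"] by simp

lemma L2_zero: "(\<lambda>x. 0) \<in> L2_torus"
  by (rule L2I_bounded[where B=0]) auto

lemma L2_sum:
  assumes "\<And>i. i \<in> F \<Longrightarrow> f i \<in> L2_torus"
  shows "(\<lambda>x. \<Sum>i\<in>F. f i x) \<in> L2_torus"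
  using assms by (induct F rule: infinite_finite_induct) (auto intro: L2_zero L2_add)

lemma L2_integrable_product:
  assumes "f \<in> L2_torus" "g \<in> L2_torus"
  shows "integrable torus (\<lambda>x. f x * g x)"
proof (rule Bochner_Integration.integrable_bound)
  show "integrable torus (\<lambda>x. (cmod (f x))\<^sup>2 + (cmod (g x))\<^sup>2)"
    using assms by (auto simp: L2_torus_def)
  have "cmod (f x * g x) \<le> (cmod (f x))\<^sup>2 + (cmod (g x))\<^sup>2" for x
  proof -
    have "2 * (cmod (f x) * cmod (g x)) \<le> (cmod (f x))\<^sup>2 + (cmod (g x))\<^sup>2"
      using sum_squares_bound[of "cmod (f x)" "cmod (g x)"] by (simp add: mult.assoc)
    moreover have "0 \<le> cmod (f x) * cmod (g x)" by simp
    ultimately show ?thesis unfolding norm_mult by linarith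
  qed
  then show "AE x in torus. norm (f x * g x) \<le> norm ((cmod (f x))\<^sup>2 + (cmod (g x))\<^sup>2)"
    by (auto intro!: AE_I2)
qed (use assms in \<open>auto simp: L2_torus_def\<close>)

lemma L2_norm_nonneg: "0 \<le> L2_norm f"
  by (simp add: L2_norm_def)

lemma L2_norm_sq: "(L2_norm f)\<^sup>2 = (LINT x|torus. (cmod (f x))\<^sup>2)"
  by (simp add: L2_norm_def)

lemma L2_norm_cmult: "L2_norm (\<lambda>x. c * f x) = cmod c * L2_norm f"
  by (simp add: L2_norm_def norm_mult power_mult_distrib real_sqrt_mult)

lemma L2_norm_cong:
  assumes "f \<in> borel_measurable torus" "g \<in> borel_measurable torus" "AE x in torus. f x = g x"
  shows "L2_norm f = L2_norm g"
  unfolding L2_norm_def by (intro arg_cong[where f=sqrt] integral_cong_AE) (use assms in auto)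

lemma L2_norm_sq_mono:
  assumes "f \<in> borel_measurable torus" "g \<in> L2_torus" "0 \<le> B"
    and "\<And>x. x \<in> {0..<2*pi} \<Longrightarrow> (cmod (f x))\<^sup>2 \<le> B * (cmod (g x))\<^sup>2"
  shows "(L2_norm f)\<^sup>2 \<le> B * (L2_norm g)\<^sup>2"
proof -
  have f: "f \<in> L2_torus"
    by (rule L2I_dominated[of _ "\<lambda>x. B * (cmod (g x))\<^sup>2"]) (use assms in \<open>auto simp: L2_torus_def\<close>)
  have "(LINT x|torus. (cmod (f x))\<^sup>2) \<le> (LINT x|torus. B * (cmod (g x))\<^sup>2)"
    by (rule integral_mono) (use assms f in \<open>auto simp: L2_torus_def\<close>)
  then show ?thesis by (simp add: L2_norm_sq)
qed

lemma L2_norm_add_sq_le: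
  assumes "f \<in> L2_torus" "g \<in> L2_torus"
  shows "(L2_norm (\<lambda>x. f x + g x))\<^sup>2 \<le> 2 * (L2_norm f)\<^sup>2 + 2 * (L2_norm g)\<^sup>2"
proof -
  have "(LINT x|torus. (cmod (f x + g x))\<^sup>2) \<le> (LINT x|torus. 2 * (cmod (f x))\<^sup>2 + 2 * (cmod (g x))\<^sup>2)"
    by (rule integral_mono) (use assms L2_add[OF assms] in \<open>auto simp: L2_torus_def intro: cmod_add_sq_le\<close>)
  also have "\<dots> = 2 * (L2_norm f)\<^sup>2 + 2 * (L2_norm g)\<^sup>2"
    using assms by (subst Bochner_Integration.integral_add) (auto simp: L2_torus_def L2_norm_sq)
  finally show ?thesis by (simp add: L2_norm_sq)
qed

lemma L2_norm_scaled_unit: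
  assumes "L2_norm f \<noteq> 0"
  shows "L2_norm (\<lambda>x. of_real (1 / L2_norm f) * f x) = 1"
  unfolding L2_norm_cmult norm_of_real using assms L2_norm_nonneg[of f] by simp

lemma cutoff_L2:
  assumes "Y \<in> sets torus" "f \<in> L2_torus"
  shows "cutoff Y f \<in> L2_torus"
  unfolding cutoff_def
  by (rule L2_mult_bounded[where B=1]) (use assms in \<open>auto split: split_indicator\<close>)

lemma L2_norm_cutoff_sq_le:
  assumes "Y \<in> sets torus" "f \<in> L2_torus"
  shows "(L2_norm (cutoff Y f))\<^sup>2 \<le> (L2_norm f)\<^sup>2"
  using L2_norm_sq_mono[of "cutoff Y f" f 1] L2_measurable[OF cutoff_L2[OF assms]] assms(2)
  by (auto simp: cutoff_def split: split_indicator)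

section \<open>Fourier coefficients and best approximation\<close>

lemma fourier_mode_cis: "fourier_mode k x = cis (of_int k * x)"
  by (simp add: fourier_mode_def cis_conv_exp mult.assoc)

lemma norm_fourier_mode [simp]: "cmod (fourier_mode k x) = 1"
  by (simp add: fourier_mode_cis)

lemma cnj_fourier_mode: "cnj (fourier_mode k x) = fourier_mode (- k) x"
  by (simp add: fourier_mode_cis cis_cnj)

lemma fourier_mode_add: "fourier_mode (k + l) x = fourier_mode k x * fourier_mode l x"
  by (simp add: fourier_mode_cis cis_mult algebra_simps)

lemma fourier_mode_0 [simp]: "fourier_mode 0 x = 1"
  by (simp add: fourier_mode_cis)

lemma continuous_on_fourier_mode: "continuous_on S (fourier_mode k)"
  unfolding fourier_mode_def by (intro continuous_intros)

lemma fourier_mode_measurable [measurable]: "fourier_mode k \<in> borel_measurable borel"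
  by (rule borel_measurable_continuous_onI) (rule continuous_on_fourier_mode)

lemma fourier_mode_measurable_torus [measurable]: "fourier_mode k \<in> borel_measurable torus"
  by (rule borel_measurable_torusI) measurable

lemma L2_fourier_mode: "fourier_mode k \<in> L2_torus"
  by (rule L2I_bounded[where B=1]) auto

lemma L2_mult_mode: "f \<in> L2_torus \<Longrightarrow> (\<lambda>x. fourier_mode k x * f x) \<in> L2_torus"
  by (rule L2_mult_bounded[where B=1]) auto

lemma L2_integrable_coeff: "f \<in> L2_torus \<Longrightarrow> integrable torus (\<lambda>x. cnj (fourier_mode j x) * f x)"
  unfolding cnj_fourier_mode by (rule L2_integrable_product[OF L2_fourier_mode])

lemma fourier_coeff_add:
  assumes "f \<in> L2_torus" "g \<in> L2_torus"
  shows "fourier_coeff (\<lambda>x. f x + g x) j = fourier_coeff f j + fourier_coeff g j"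
  unfolding fourier_coeff_def
  by (simp add: ring_distribs Bochner_Integration.integral_add L2_integrable_coeff assms)

lemma fourier_coeff_cmult: "fourier_coeff (\<lambda>x. c * f x) j = c * fourier_coeff f j"
  unfolding fourier_coeff_def by (simp add: mult.left_commute[of _ c])

lemma fourier_coeff_diff:
  assumes "f \<in> L2_torus" "g \<in> L2_torus"
  shows "fourier_coeff (\<lambda>x. f x - g x) j = fourier_coeff f j - fourier_coeff g j"
  using fourier_coeff_add[OF assms(1) L2_cmult[OF assms(2), of "-1"]] fourier_coeff_cmult[of "-1" g j]
  by simp

lemma fourier_coeff_sum:
  assumes "\<And>i. i \<in> F \<Longrightarrow> f i \<in> L2_torus"
  shows "fourier_coeff (\<lambda>x. \<Sum>i\<in>F. f i x) j = (\<Sum>i\<in>F. fourier_coeff (f i) j)"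
  using assms
proof (induct F rule: infinite_finite_induct)
  case (insert i F)
  then show ?case by (simp add: fourier_coeff_add L2_sum)
qed (auto simp: fourier_coeff_def)

lemma fourier_coeff_cong:
  assumes "f \<in> borel_measurable torus" "g \<in> borel_measurable torus" "AE x in torus. f x = g x"
  shows "fourier_coeff f j = fourier_coeff g j"
  unfolding fourier_coeff_def cnj_fourier_mode by (intro integral_cong_AE) (use assms in auto)

lemma fourier_coeff_mult_mode:
  "fourier_coeff (\<lambda>x. fourier_mode k x * f x) j = fourier_coeff f (j - k)"
proof -
  have "cnj (fourier_mode j x) * (fourier_mode k x * f x) = cnj (fourier_mode (j - k) x) * f x" for x
    using fourier_mode_add[of "-j" k x] by (simp add: cnj_fourier_mode mult.assoc)
  then show ?thesis unfolding fourier_coeff_def by (simp only:)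
qed

lemma mode_has_vector_derivative:
  assumes "k \<noteq> 0"
  shows "((\<lambda>x. fourier_mode k x / (\<i> * of_int k)) has_vector_derivative fourier_mode k x) (at x)"
proof -
  have "((\<lambda>z. exp (\<i> * of_int k * z) / (\<i> * of_int k)) has_field_derivative
      exp (\<i> * of_int k * of_real x)) (at (of_real x))"
    using assms by (auto intro!: derivative_eq_intros)
  from has_vector_derivative_real_field[OF this] show ?thesis
    by (simp add: fourier_mode_def)
qed

lemma fourier_mode_2pi [simp]: "fourier_mode k (2*pi) = 1"
  using cis_multiple_2pi[of "of_int k"] by (simp add: fourier_mode_cis mult.commute mult.left_commute)

lemma fourier_mode_at_0 [simp]: "fourier_mode k 0 = 1"
  by (simp add: fourier_mode_cis)

lemma integral_fourier_mode: "(LINT x|torus. fourier_mode k x) = (if k = 0 then 1 else 0)"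
proof (cases "k = 0")
  case True
  then show ?thesis by (simp add: fourier_mode_cis)
next
  case False
  then show ?thesis
    using has_bochner_integral_torus_FTC_full[OF mode_has_vector_derivative[OF False] continuous_on_fourier_mode]
    by (simp add: has_bochner_integral_iff)
qed

lemma fourier_coeff_mode: "fourier_coeff (fourier_mode k) j = (if j = k then 1 else 0)"
proof -
  have "fourier_coeff (fourier_mode k) j = (LINT x|torus. fourier_mode (k - j) x)"
    unfolding fourier_coeff_def cnj_fourier_mode fourier_mode_add[symmetric] by simp
  then show ?thesis by (simp add: integral_fourier_mode)
qed

lemma L2_norm_sq_diff_mode:
  assumes "f \<in> L2_torus"
  shows "(L2_norm (\<lambda>x. f x - c * fourier_mode k x))\<^sup>2 =
    (L2_norm f)\<^sup>2 - (cmod (fourier_coeff f k))\<^sup>2 + (cmod (fourier_coeff f k - c))\<^sup>2"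
proof -
  have pt: "(cmod (a - c * e))\<^sup>2 = (cmod a)\<^sup>2 - 2 * Re (cnj c * (cnj e * a)) + (cmod c)\<^sup>2"
    if "cmod e = 1" for a e :: complex
  proof -
    have "(cmod (a - c * e))\<^sup>2 = (cmod a)\<^sup>2 - 2 * Re (cnj c * (cnj e * a)) + (cmod (c * e))\<^sup>2"
      unfolding cmod_power2 by (simp add: power2_eq_square algebra_simps)
    then show ?thesis using that by (simp add: norm_mult)
  qed
  have int: "integrable torus (\<lambda>x. cnj c * (cnj (fourier_mode k x) * f x))"
    using L2_integrable_coeff[OF assms] by simp
  have "(L2_norm (\<lambda>x. f x - c * fourier_mode k x))\<^sup>2 =
      (LINT x|torus. (cmod (f x))\<^sup>2 - 2 * Re (cnj c * (cnj (fourier_mode k x) * f x)) + (cmod c)\<^sup>2)"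
    unfolding L2_norm_sq by (rule Bochner_Integration.integral_cong[OF refl], rule pt) simp
  also have "\<dots> = (LINT x|torus. (cmod (f x))\<^sup>2)
      - 2 * (LINT x|torus. Re (cnj c * (cnj (fourier_mode k x) * f x))) + (cmod c)\<^sup>2"
  proof -
    have "(LINT x|torus. u x - 2 * v x + (cmod c)\<^sup>2) = (LINT x|torus. u x) - 2 * (LINT x|torus. v x) + (cmod c)\<^sup>2"
      if "integrable torus u" "integrable torus v" for u v :: "real \<Rightarrow> real"
      using that by simp
    from this[OF L2_square_integrable[OF assms] integrable_Re[OF int]] show ?thesis .
  qed
  also have "(LINT x|torus. Re (cnj c * (cnj (fourier_mode k x) * f x))) = Re (cnj c * fourier_coeff f k)"
    using integral_Re[OF int] by (simp add: fourier_coeff_def)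
  also have "(LINT x|torus. (cmod (f x))\<^sup>2) - 2 * Re (cnj c * fourier_coeff f k) + (cmod c)\<^sup>2
     = (L2_norm f)\<^sup>2 - (cmod (fourier_coeff f k))\<^sup>2 + (cmod (fourier_coeff f k - c))\<^sup>2"
    using pt[of 1 "fourier_coeff f k"] by (simp add: L2_norm_sq)
  finally show ?thesis .
qed

lemma L2_trig_sum: "(\<lambda>x. \<Sum>k\<in>F. a k * fourier_mode k x) \<in> L2_torus"
  by (intro L2_sum L2_cmult L2_fourier_mode)

text \<open>
  Pythagoras: the squared error of a trigonometric sum splits into the defect of \<open>f\<close> in
  Bessel's inequality and the distance of the coefficients from the optimal ones. It yields both
  Bessel's inequality and the optimality of the Fourier coefficients.
\<close>

lemma L2_norm_sq_diff_trig_sum: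
  assumes "f \<in> L2_torus" "finite F"
  shows "(L2_norm (\<lambda>x. f x - (\<Sum>k\<in>F. a k * fourier_mode k x)))\<^sup>2 =
    (L2_norm f)\<^sup>2 - (\<Sum>k\<in>F. (cmod (fourier_coeff f k))\<^sup>2) + (\<Sum>k\<in>F. (cmod (fourier_coeff f k - a k))\<^sup>2)"
  using assms(2)
proof (induct F)
  case empty
  then show ?case by simp
next
  case (insert k F)
  define g where "g = (\<lambda>x. f x - (\<Sum>k\<in>F. a k * fourier_mode k x))"
  have g: "g \<in> L2_torus"
    unfolding g_def by (intro L2_diff assms L2_trig_sum)
  have "fourier_coeff g k = fourier_coeff f k - (\<Sum>l\<in>F. a l * (if k = l then 1 else 0))"
    unfolding g_def fourier_coeff_diff[OF assms(1) L2_trig_sum]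
    by (subst fourier_coeff_sum) (auto simp: L2_cmult L2_fourier_mode fourier_coeff_cmult fourier_coeff_mode)
  also have "\<dots> = fourier_coeff f k"
    using insert by (simp add: if_distrib sum.If_cases cong: if_cong)
  finally have gk: "fourier_coeff g k = fourier_coeff f k" .
  have "(\<lambda>x. f x - (\<Sum>k\<in>insert k F. a k * fourier_mode k x)) = (\<lambda>x. g x - a k * fourier_mode k x)"
    using insert by (simp add: g_def fun_eq_iff)
  then show ?case
    using insert L2_norm_sq_diff_mode[OF g, of "a k" k] gk by (simp add: g_def)
qed

lemma Bessel:
  assumes "f \<in> L2_torus" "finite F"
  shows "(\<Sum>k\<in>F. (cmod (fourier_coeff f k))\<^sup>2) \<le> (L2_norm f)\<^sup>2"
proof -
  have "(L2_norm f)\<^sup>2 - (\<Sum>k\<in>F. (cmod (fourier_coeff f k))\<^sup>2) \<ge> 0"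
    using L2_norm_sq_diff_trig_sum[OF assms, of "fourier_coeff f"]
      zero_le_power2[of "L2_norm (\<lambda>x. f x - (\<Sum>k\<in>F. fourier_coeff f k * fourier_mode k x))"]
    by simp
  then show ?thesis by simp
qed

lemma norm_fourier_coeff_le:
  assumes "f \<in> L2_torus"
  shows "cmod (fourier_coeff f k) \<le> L2_norm f"
  by (rule power2_le_imp_le[OF _ L2_norm_nonneg]) (use Bessel[OF assms, of "{k}"] in simp)

section \<open>Completeness of the Fourier basis\<close>

text \<open>
  Membership in the \<open>L\<^sup>2\<close>-closure of the trigonometric polynomials, with arbitrary coefficients:
  in this form closure under limits needs no control of the coefficients.
\<close>

definition trig_approximable :: "(real \<Rightarrow> complex) \<Rightarrow> bool" where
  "trig_approximable f \<longleftrightarrow> f \<in> L2_torus \<and>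
     (\<forall>\<epsilon>>0. \<exists>F a. finite F \<and> (L2_norm (\<lambda>x. f x - (\<Sum>k\<in>F. a k * fourier_mode k x)))\<^sup>2 < \<epsilon>)"

text \<open>
  The Fourier coefficients are the best choice, so only the defect in Bessel's inequality matters.
  This also allows the frequency set of an approximation to be enlarged at will.
\<close>

lemma trig_approximable_iff:
  assumes "f \<in> L2_torus"
  shows "trig_approximable f \<longleftrightarrow>
    (\<forall>\<epsilon>>0. \<exists>F. finite F \<and> (L2_norm f)\<^sup>2 - (\<Sum>k\<in>F. (cmod (fourier_coeff f k))\<^sup>2) < \<epsilon>)"
    (is "_ \<longleftrightarrow> ?R")
proof
  assume L: "trig_approximable f"
  show ?R
  proof (intro allI impI)
    fix \<epsilon> :: real assume "\<epsilon> > 0"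
    with L obtain F a where F: "finite F"
      and "(L2_norm (\<lambda>x. f x - (\<Sum>k\<in>F. a k * fourier_mode k x)))\<^sup>2 < \<epsilon>"
      unfolding trig_approximable_def by blast
    moreover have "0 \<le> (\<Sum>k\<in>F. (cmod (fourier_coeff f k - a k))\<^sup>2)"
      by (intro sum_nonneg) auto
    ultimately have "(L2_norm f)\<^sup>2 - (\<Sum>k\<in>F. (cmod (fourier_coeff f k))\<^sup>2) < \<epsilon>"
      unfolding L2_norm_sq_diff_trig_sum[OF assms F] by linarith
    with F show "\<exists>F. finite F \<and> (L2_norm f)\<^sup>2 - (\<Sum>k\<in>F. (cmod (fourier_coeff f k))\<^sup>2) < \<epsilon>" by blast
  qed
next
  assume R: ?R
  show "trig_approximable f"
    unfolding trig_approximable_def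
  proof (intro conjI assms allI impI)
    fix \<epsilon> :: real assume "\<epsilon> > 0"
    with R obtain F where F: "finite F" "(L2_norm f)\<^sup>2 - (\<Sum>k\<in>F. (cmod (fourier_coeff f k))\<^sup>2) < \<epsilon>"
      by blast
    then show "\<exists>F a. finite F \<and> (L2_norm (\<lambda>x. f x - (\<Sum>k\<in>F. a k * fourier_mode k x)))\<^sup>2 < \<epsilon>"
      by (intro exI[of _ F] exI[of _ "fourier_coeff f"]) (simp add: L2_norm_sq_diff_trig_sum[OF assms])
  qed
qed

lemma trig_approximable_L2: "trig_approximable f \<Longrightarrow> f \<in> L2_torus"
  by (simp add: trig_approximable_def)

lemma trig_approximable_limit:
  assumes f: "f \<in> L2_torus"
    and lim: "\<And>\<epsilon>. \<epsilon> > 0 \<Longrightarrow> \<exists>g. trig_approximable g \<and> (L2_norm (\<lambda>x. f x - g x))\<^sup>2 < \<epsilon>"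
  shows "trig_approximable f"
  unfolding trig_approximable_def
proof (intro conjI f allI impI)
  fix \<epsilon> :: real assume "\<epsilon> > 0"
  then obtain g where g: "trig_approximable g" "(L2_norm (\<lambda>x. f x - g x))\<^sup>2 < \<epsilon> / 4"
    using lim[of "\<epsilon>/4"] by auto
  with \<open>\<epsilon> > 0\<close> obtain F a where F: "finite F"
    and a: "(L2_norm (\<lambda>x. g x - (\<Sum>k\<in>F. a k * fourier_mode k x)))\<^sup>2 < \<epsilon> / 4"
    unfolding trig_approximable_def by (meson divide_pos_pos zero_less_numeral)
  note gL = trig_approximable_L2[OF g(1)]
  have "(L2_norm (\<lambda>x. (f x - g x) + (g x - (\<Sum>k\<in>F. a k * fourier_mode k x))))\<^sup>2
      \<le> 2 * (L2_norm (\<lambda>x. f x - g x))\<^sup>2 + 2 * (L2_norm (\<lambda>x. g x - (\<Sum>k\<in>F. a k * fourier_mode k x)))\<^sup>2"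
    by (intro L2_norm_add_sq_le L2_diff f gL L2_trig_sum)
  also have "\<dots> < \<epsilon>" using g(2) a by simp
  finally show "\<exists>F a. finite F \<and> (L2_norm (\<lambda>x. f x - (\<Sum>k\<in>F. a k * fourier_mode k x)))\<^sup>2 < \<epsilon>"
    using F by (intro exI[of _ F] exI[of _ a]) simp
qed

lemma trig_approximable_cmult:
  assumes "trig_approximable f"
  shows "trig_approximable (\<lambda>x. c * f x)"
proof (cases "c = 0")
  case True
  then show ?thesis
    by (subst trig_approximable_iff) (auto simp: L2_zero L2_norm_def intro!: exI[of _ "{}"])
next
  case False
  show ?thesis
    unfolding trig_approximable_def
  proof (intro conjI allI impI)
    fix \<epsilon> :: real assume "\<epsilon> > 0"
    then have "\<epsilon> / (cmod c)\<^sup>2 > 0" using False by simp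
    then obtain F a where F: "finite F"
      and a: "(L2_norm (\<lambda>x. f x - (\<Sum>k\<in>F. a k * fourier_mode k x)))\<^sup>2 < \<epsilon> / (cmod c)\<^sup>2"
      using assms unfolding trig_approximable_def by blast
    have eq: "(\<lambda>x. c * f x - (\<Sum>k\<in>F. (c * a k) * fourier_mode k x))
        = (\<lambda>x. c * (f x - (\<Sum>k\<in>F. a k * fourier_mode k x)))"
      by (simp add: algebra_simps sum_distrib_left)
    have "(L2_norm (\<lambda>x. c * f x - (\<Sum>k\<in>F. (c * a k) * fourier_mode k x)))\<^sup>2 < \<epsilon>"
      unfolding eq L2_norm_cmult power_mult_distrib using a False by (simp add: field_simps)
    with F show "\<exists>F a. finite F \<and> (L2_norm (\<lambda>x. c * f x - (\<Sum>k\<in>F. a k * fourier_mode k x)))\<^sup>2 < \<epsilon>"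
      by (intro exI[of _ F] exI[of _ "\<lambda>k. c * a k"] conjI)
  qed (use assms in \<open>auto intro: L2_cmult trig_approximable_L2\<close>)
qed

lemma trig_approximable_add:
  assumes f: "trig_approximable f" and g: "trig_approximable g"
  shows "trig_approximable (\<lambda>x. f x + g x)"
proof -
  note fL = trig_approximable_L2[OF f] note gL = trig_approximable_L2[OF g]
  show ?thesis
    unfolding trig_approximable_def
  proof (intro conjI allI impI)
    fix \<epsilon> :: real assume "\<epsilon> > 0"
    then have e: "\<epsilon> / 4 > 0" by simp
    obtain F where F: "finite F" "(L2_norm f)\<^sup>2 - (\<Sum>k\<in>F. (cmod (fourier_coeff f k))\<^sup>2) < \<epsilon> / 4"
      using f e trig_approximable_iff[OF fL] by blast
    obtain G where G: "finite G" "(L2_norm g)\<^sup>2 - (\<Sum>k\<in>G. (cmod (fourier_coeff g k))\<^sup>2) < \<epsilon> / 4"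
      using g e trig_approximable_iff[OF gL] by blast
    let ?H = "F \<union> G"
    have H: "finite ?H" using F G by simp
    let ?S = "\<lambda>h x. \<Sum>k\<in>?H. fourier_coeff h k * fourier_mode k x"
    have "(\<Sum>k\<in>F. (cmod (fourier_coeff f k))\<^sup>2) \<le> (\<Sum>k\<in>?H. (cmod (fourier_coeff f k))\<^sup>2)"
      by (intro sum_mono2 H) auto
    then have 1: "(L2_norm (\<lambda>x. f x - ?S f x))\<^sup>2 < \<epsilon> / 4"
      using F by (subst L2_norm_sq_diff_trig_sum[OF fL H]) simp
    have "(\<Sum>k\<in>G. (cmod (fourier_coeff g k))\<^sup>2) \<le> (\<Sum>k\<in>?H. (cmod (fourier_coeff g k))\<^sup>2)"
      by (intro sum_mono2 H) auto
    then have 2: "(L2_norm (\<lambda>x. g x - ?S g x))\<^sup>2 < \<epsilon> / 4"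
      using G by (subst L2_norm_sq_diff_trig_sum[OF gL H]) simp
    have eq: "(\<lambda>x. f x + g x - (\<Sum>k\<in>?H. (fourier_coeff f k + fourier_coeff g k) * fourier_mode k x))
      = (\<lambda>x. (f x - ?S f x) + (g x - ?S g x))"
      by (simp add: algebra_simps sum.distrib)
    have "(L2_norm (\<lambda>x. (f x - ?S f x) + (g x - ?S g x)))\<^sup>2
        \<le> 2 * (L2_norm (\<lambda>x. f x - ?S f x))\<^sup>2 + 2 * (L2_norm (\<lambda>x. g x - ?S g x))\<^sup>2"
      by (intro L2_norm_add_sq_le L2_diff fL gL L2_trig_sum)
    also have "\<dots> < \<epsilon>" using 1 2 by simp
    finally show "\<exists>F a. finite F \<and> (L2_norm (\<lambda>x. f x + g x - (\<Sum>k\<in>F. a k * fourier_mode k x)))\<^sup>2 < \<epsilon>"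
      unfolding eq[symmetric]
      by (intro exI[of _ ?H] exI[of _ "\<lambda>k. fourier_coeff f k + fourier_coeff g k"] conjI H)
  qed (intro L2_add fL gL)
qed

lemma trig_approximable_zero: "trig_approximable (\<lambda>x. 0)"
  by (subst trig_approximable_iff) (auto simp: L2_zero L2_norm_def intro!: exI[of _ "{}"])

lemma trig_approximable_sum:
  assumes "\<And>i. i \<in> F \<Longrightarrow> trig_approximable (f i)"
  shows "trig_approximable (\<lambda>x. \<Sum>i\<in>F. f i x)"
  using assms
  by (induct F rule: infinite_finite_induct)
    (auto intro: trig_approximable_zero trig_approximable_add)

lemma trig_approximable_one: "trig_approximable (\<lambda>x. 1)"
  unfolding trig_approximable_def
proof (intro conjI allI impI)
  show "(\<lambda>x. 1) \<in> L2_torus"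
    by (rule L2I_bounded[where B=1]) auto
  fix \<epsilon> :: real assume "\<epsilon> > 0"
  then have "(L2_norm (\<lambda>x. 1 - (\<Sum>k\<in>{0}. 1 * fourier_mode k x)))\<^sup>2 < \<epsilon>"
    by (simp add: L2_norm_def)
  then show "\<exists>F a. finite F \<and> (L2_norm (\<lambda>x. 1 - (\<Sum>k\<in>F. a k * fourier_mode k x)))\<^sup>2 < \<epsilon>"
    using finite.emptyI finite.insertI by (intro exI[of _ "{0::int}"] exI[of _ "\<lambda>_. 1"] conjI) auto
qed

lemma trig_approximable_dominated_limit:
  fixes f :: "real \<Rightarrow> complex"
  assumes f: "f \<in> L2_torus" and s: "\<And>i. trig_approximable (s i)"
    and lim: "\<And>x. x \<in> {0..<2*pi} \<Longrightarrow> (\<lambda>i. s i x) \<longlonglongrightarrow> f x"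
    and g: "integrable torus g"
    and bound: "\<And>i x. x \<in> {0..<2*pi} \<Longrightarrow> (cmod (f x - s i x))\<^sup>2 \<le> g x"
  shows "trig_approximable f"
proof (rule trig_approximable_limit[OF f])
  fix \<epsilon> :: real assume "\<epsilon> > 0"
  have "(\<lambda>i. LINT x|torus. (cmod (f x - s i x))\<^sup>2) \<longlonglongrightarrow> (LINT x|torus. 0::real)"
  proof (rule integral_dominated_convergence[where w=g])
    show "AE x in torus. (\<lambda>i. (cmod (f x - s i x))\<^sup>2) \<longlonglongrightarrow> 0"
    proof (rule AE_I2)
      fix x assume "x \<in> space torus"
      then have "(\<lambda>i. f x - s i x) \<longlonglongrightarrow> f x - f x"
        using lim by (intro tendsto_diff) auto
      then have "(\<lambda>i. (cmod (f x - s i x))\<^sup>2) \<longlonglongrightarrow> (cmod 0)\<^sup>2"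
        by (intro tendsto_power tendsto_norm) simp
      then show "(\<lambda>i. (cmod (f x - s i x))\<^sup>2) \<longlonglongrightarrow> 0" by simp
    qed
    show "\<And>i. (\<lambda>x. (cmod (f x - s i x))\<^sup>2) \<in> borel_measurable torus"
      using L2_measurable[OF f] L2_measurable[OF trig_approximable_L2[OF s]] by measurable
  qed (use g bound in auto)
  then have "(\<lambda>i. (L2_norm (\<lambda>x. f x - s i x))\<^sup>2) \<longlonglongrightarrow> 0"
    by (simp add: L2_norm_sq)
  from order_tendstoD(2)[OF this \<open>\<epsilon> > 0\<close>] obtain i where "(L2_norm (\<lambda>x. f x - s i x))\<^sup>2 < \<epsilon>"
    by (auto simp: eventually_sequentially)
  with s show "\<exists>g. trig_approximable g \<and> (L2_norm (\<lambda>x. f x - g x))\<^sup>2 < \<epsilon>" by blast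
qed

lemma fourier_coeff_of_real_ident:
  "fourier_coeff of_real k = (if k = 0 then of_real pi else \<i> / of_int k)"
proof (cases "k = 0")
  case True
  have "((\<lambda>x. of_real (x\<^sup>2 / 2)) has_vector_derivative (of_real x :: complex)) (at x)" for x :: real
    by (rule has_vector_derivative_of_real) (auto intro!: derivative_eq_intros)
  from has_bochner_integral_torus_FTC_full[OF this] True show ?thesis
    unfolding fourier_coeff_def
    by (simp add: has_bochner_integral_iff continuous_intros power2_eq_square scaleR_conv_of_real)
next
  case False
  define E where "E = (\<lambda>x. fourier_mode (- k) x / (\<i> * of_int (- k)))"
  have E: "(E has_vector_derivative fourier_mode (- k) x) (at x)" for x
    unfolding E_def by (rule mode_has_vector_derivative) (use False in simp)
  let ?G = "\<lambda>x. of_real x * E x - E x / (\<i> * of_int (- k))"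
  have "(?G has_vector_derivative cnj (fourier_mode k x) * of_real x) (at x)" for x
  proof -
    have "((\<lambda>x. of_real x :: complex) has_vector_derivative 1) (at x)"
      using has_vector_derivative_of_real[of "\<lambda>x. x" 1] by simp
    then have "(?G has_vector_derivative (of_real x * fourier_mode (- k) x + 1 * E x
        - fourier_mode (- k) x / (\<i> * of_int (- k)))) (at x)"
      by (intro has_vector_derivative_diff has_vector_derivative_mult has_vector_derivative_divide E)
    then show ?thesis by (simp add: E_def cnj_fourier_mode mult.commute)
  qed
  then have "has_bochner_integral torus (\<lambda>x. cnj (fourier_mode k x) * of_real x)
      ((1 / (2*pi)) *\<^sub>R (?G (2*pi) - ?G 0))"
    by (rule has_bochner_integral_torus_FTC_full)
      (auto simp: cnj_fourier_mode intro!: continuous_intros continuous_on_fourier_mode)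
  from has_bochner_integral_integral_eq[OF this]
  have "fourier_coeff of_real k = (1 / (2*pi)) *\<^sub>R (?G (2*pi) - ?G 0)"
    unfolding fourier_coeff_def .
  moreover have "E (2*pi) = \<i> / of_int k" "E 0 = \<i> / of_int k"
    unfolding E_def fourier_mode_2pi fourier_mode_at_0 using False by (simp_all add: divide_simps)
  ultimately show ?thesis
    using False by (simp add: scaleR_conv_of_real)
qed

lemma fourier_coeff_indicator_lessThan:
  assumes a: "0 \<le> a" "a \<le> 2*pi"
  shows "fourier_coeff (indicator {..<a}) k =
    (if k = 0 then of_real (a / (2*pi)) else \<i> * (fourier_mode (- k) a - 1) / (2 * of_real pi * of_int k))"
proof -
  have *: "fourier_coeff (indicator {..<a}) k = (LINT x|torus. indicator {..<a} x *\<^sub>R fourier_mode (- k) x)"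
    unfolding fourier_coeff_def cnj_fourier_mode
    by (intro Bochner_Integration.integral_cong) (auto split: split_indicator)
  show ?thesis
  proof (cases "k = 0")
    case True
    have "((\<lambda>x. of_real x :: complex) has_vector_derivative fourier_mode (- k) x) (at x)" for x
      using has_vector_derivative_of_real[of "\<lambda>x. x" 1] True by simp
    from has_bochner_integral_torus_FTC[OF a this continuous_on_fourier_mode] True show ?thesis
      unfolding * by (simp add: has_bochner_integral_iff scaleR_conv_of_real)
  next
    case False
    then have "- k \<noteq> 0" by simp
    from has_bochner_integral_integral_eq[OF has_bochner_integral_torus_FTC[OF a
          mode_has_vector_derivative[OF this] continuous_on_fourier_mode]]
    have "fourier_coeff (indicator {..<a}) k = (1 / (2*pi)) *\<^sub>R
        ((fourier_mode (- k) a - 1) / (\<i> * of_int (- k)))"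
      unfolding * by (simp add: diff_divide_distrib)
    also have "\<dots> = \<i> * (fourier_mode (- k) a - 1) / (2 * of_real pi * of_int k)"
      using False by (simp add: scaleR_conv_of_real divide_simps)
    finally show ?thesis using False by simp
  qed
qed

text \<open>
  Up to an additive constant this is the sawtooth with its jump at \<open>a\<close>, so its coefficients of
  index \<open>k \<noteq> 0\<close> have modulus \<open>1 / |k|\<close> for every \<open>a\<close>. The Basel series
  evaluates the sum of their squares, and this is exactly what the squared norm requires.
\<close>

lemma sawtooth_approximable:
  assumes a: "0 \<le> a" "a \<le> 2*pi"
  shows "trig_approximable (\<lambda>x. of_real x + 2 * of_real pi * indicator {..<a} x)"
proof -
  let ?f = "\<lambda>x. of_real x + 2 * of_real pi * indicator {..<a} x :: complex"
  have x: "(of_real :: real \<Rightarrow> complex) \<in> L2_torus"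
    by (rule L2I_bounded[where B="2*pi"]) (auto intro: borel_measurable_torusI)
  have i: "(indicator {..<a} :: real \<Rightarrow> complex) \<in> L2_torus"
    by (rule L2I_bounded[where B=1]) (auto intro: borel_measurable_torusI split: split_indicator)
  have f: "?f \<in> L2_torus"
    by (intro L2_add L2_cmult x i)
  have coeff: "fourier_coeff ?f k =
      (if k = 0 then of_real (pi + a) else \<i> * fourier_mode (- k) a / of_int k)" for k
  proof -
    have "fourier_coeff ?f k = fourier_coeff of_real k + 2 * of_real pi * fourier_coeff (indicator {..<a}) k"
      using fourier_coeff_add[OF x L2_cmult[OF i]] by (simp add: fourier_coeff_cmult)
    then show ?thesis
      by (auto simp: fourier_coeff_of_real_ident fourier_coeff_indicator_lessThan[OF a] field_simps)
  qed
  have norm: "(L2_norm ?f)\<^sup>2 = (pi + a)\<^sup>2 + pi\<^sup>2 / 3"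
  proof -
    have 1: "has_bochner_integral torus (\<lambda>x. x\<^sup>2) ((1 / (2*pi)) *\<^sub>R ((2*pi)^3 / 3 - 0^3 / 3))"
      by (rule has_bochner_integral_torus_FTC_full)
        (auto intro!: derivative_eq_intros continuous_intros simp: has_real_derivative_iff_has_vector_derivative[symmetric])
    have 2: "has_bochner_integral torus (\<lambda>x. indicator {..<a} x *\<^sub>R (4 * pi * x + 4 * pi\<^sup>2))
        ((1 / (2*pi)) *\<^sub>R ((2 * pi * a\<^sup>2 + 4 * pi\<^sup>2 * a) - (2 * pi * 0\<^sup>2 + 4 * pi\<^sup>2 * 0)))"
      by (rule has_bochner_integral_torus_FTC[OF a])
        (auto intro!: derivative_eq_intros continuous_intros simp: has_real_derivative_iff_has_vector_derivative[symmetric])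
    have "(cmod (?f x))\<^sup>2 = x\<^sup>2 + indicator {..<a} x *\<^sub>R (4 * pi * x + 4 * pi\<^sup>2)" for x
    proof -
      have "?f x = of_real (x + 2 * pi * indicator {..<a} x)" by (simp split: split_indicator)
      then show ?thesis
        by (simp only: norm_of_real) (auto split: split_indicator simp: power2_eq_square algebra_simps)
    qed
    then have "(L2_norm ?f)\<^sup>2 = (1 / (2*pi)) *\<^sub>R ((2*pi)^3 / 3 - 0^3 / 3) +
        (1 / (2*pi)) *\<^sub>R ((2 * pi * a\<^sup>2 + 4 * pi\<^sup>2 * a) - (2 * pi * 0\<^sup>2 + 4 * pi\<^sup>2 * 0))"
      unfolding L2_norm_sq
      by (simp only: has_bochner_integral_integral_eq[OF has_bochner_integral_add[OF 1 2]])
    also have "\<dots> = (pi + a)\<^sup>2 + pi\<^sup>2 / 3"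
      by (simp add: field_simps power2_eq_square power3_eq_cube)
    finally show ?thesis .
  qed
  show ?thesis
    unfolding trig_approximable_iff[OF f]
  proof (intro allI impI)
    fix \<epsilon> :: real assume "\<epsilon> > 0"
    have "(\<lambda>n. \<Sum>j<n. 1 / (real j + 1)\<^sup>2) \<longlonglongrightarrow> pi\<^sup>2 / 6"
      using inverse_squares_sums unfolding sums_def by (simp add: add.commute)
    then have "\<forall>\<^sub>F n in sequentially. (\<Sum>j<n. 1 / (real j + 1)\<^sup>2) > pi\<^sup>2 / 6 - \<epsilon> / 2"
      by (rule order_tendstoD) (use \<open>\<epsilon> > 0\<close> in simp)
    then obtain n where n: "(\<Sum>j<n. 1 / (real j + 1)\<^sup>2) > pi\<^sup>2 / 6 - \<epsilon> / 2"
      by (auto simp: eventually_sequentially)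
    have cn: "(cmod (fourier_coeff ?f k))\<^sup>2 = 1 / (real_of_int k)\<^sup>2" if "k \<noteq> 0" for k
      unfolding coeff using that by (simp add: norm_divide norm_mult power_divide)
    let ?P = "(\<lambda>j. int j + 1) ` {..<n}" and ?N = "(\<lambda>j. - int j - 1) ` {..<n}"
    have "(\<Sum>k\<in>?P \<union> ?N. (cmod (fourier_coeff ?f k))\<^sup>2) =
        (\<Sum>k\<in>?P. (cmod (fourier_coeff ?f k))\<^sup>2) + (\<Sum>k\<in>?N. (cmod (fourier_coeff ?f k))\<^sup>2)"
      by (rule sum.union_disjoint) auto
    also have "(\<Sum>k\<in>?P. (cmod (fourier_coeff ?f k))\<^sup>2) = (\<Sum>j<n. 1 / (real j + 1)\<^sup>2)"
    proof (subst sum.reindex)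
      have "(cmod (fourier_coeff ?f (int j + 1)))\<^sup>2 = 1 / (real j + 1)\<^sup>2" for j
        by (subst cn) (auto simp: add.commute)
      then show "sum ((\<lambda>k. (cmod (fourier_coeff ?f k))\<^sup>2) \<circ> (\<lambda>j. int j + 1)) {..<n} = (\<Sum>j<n. 1 / (real j + 1)\<^sup>2)"
        by (simp only: o_def)
    qed (auto simp: inj_on_def)
    also have "(\<Sum>k\<in>?N. (cmod (fourier_coeff ?f k))\<^sup>2) = (\<Sum>j<n. 1 / (real j + 1)\<^sup>2)"
    proof (subst sum.reindex)
      have "(cmod (fourier_coeff ?f (- int j - 1)))\<^sup>2 = 1 / (real j + 1)\<^sup>2" for j
        by (subst cn) (auto simp: power2_eq_square algebra_simps)
      then show "sum ((\<lambda>k. (cmod (fourier_coeff ?f k))\<^sup>2) \<circ> (\<lambda>j. - int j - 1)) {..<n} = (\<Sum>j<n. 1 / (real j + 1)\<^sup>2)"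
        by (simp only: o_def)
    qed (auto simp: inj_on_def)
    finally have s: "(\<Sum>k\<in>?P \<union> ?N. (cmod (fourier_coeff ?f k))\<^sup>2) > pi\<^sup>2 / 3 - \<epsilon>"
      using n by linarith
    have "(\<Sum>k\<in>insert 0 (?P \<union> ?N). (cmod (fourier_coeff ?f k))\<^sup>2) =
        (cmod (fourier_coeff ?f 0))\<^sup>2 + (\<Sum>k\<in>?P \<union> ?N. (cmod (fourier_coeff ?f k))\<^sup>2)"
      by (rule sum.insert) auto
    also have "(cmod (fourier_coeff ?f 0))\<^sup>2 = (pi + a)\<^sup>2"
      unfolding coeff by (simp only: norm_of_real if_True refl) simp
    finally show "\<exists>F. finite F \<and> (L2_norm ?f)\<^sup>2 - (\<Sum>k\<in>F. (cmod (fourier_coeff ?f k))\<^sup>2) < \<epsilon>"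
      using s unfolding norm by (intro exI[of _ "insert 0 (?P \<union> ?N)"] conjI) auto
  qed
qed

text \<open>
  The difference of two sawtooths is constant except for the jumps, hence an indicator of an arc.
\<close>

lemma indicator_lessThan_approximable: "trig_approximable (indicator {..<a})"
proof -
  \<comment> \<open>on the fundamental domain only the part of the half-line inside it is visible\<close>
  define b where "b = min (max a 0) (2*pi)"
  have b: "0 \<le> b" "b \<le> 2*pi" by (auto simp: b_def)
  have "trig_approximable (\<lambda>x. (1 / (2 * of_real pi)) *
      ((of_real x + 2 * of_real pi * indicator {..<b} x) + (-1) * (of_real x + 2 * of_real pi * indicator {..<0} x)))"
    by (intro trig_approximable_cmult trig_approximable_add sawtooth_approximable b) auto
  also have "(\<lambda>x. (1 / (2 * of_real pi)) *
      ((of_real x + 2 * of_real pi * indicator {..<b} x) + (-1) * (of_real x + 2 * of_real pi * indicator {..<0} x)))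
    = (\<lambda>x. indicator {..<b} x - indicator {..<0} x :: complex)"
    by (auto simp: fun_eq_iff field_simps)
  finally have t: "trig_approximable (\<lambda>x. indicator {..<b} x - indicator {..<0} x)" .
  show ?thesis
  proof (rule trig_approximable_limit)
    show "(indicator {..<a} :: real \<Rightarrow> complex) \<in> L2_torus"
      by (rule L2I_bounded[where B=1]) (auto intro: borel_measurable_torusI split: split_indicator)
    fix \<epsilon> :: real assume "\<epsilon> > 0"
    have "L2_norm (\<lambda>x. indicator {..<a} x - (indicator {..<b} x - indicator {..<0} x)) = L2_norm (\<lambda>x. 0)"
      unfolding L2_norm_def
      by (intro arg_cong[where f=sqrt] Bochner_Integration.integral_cong refl)
        (auto simp: b_def split: split_indicator)
    then have "(L2_norm (\<lambda>x. indicator {..<a} x - (indicator {..<b} x - indicator {..<0} x)))\<^sup>2 < \<epsilon>"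
      using \<open>\<epsilon> > 0\<close> by (simp add: L2_norm_def)
    with t show "\<exists>g. trig_approximable g \<and> (L2_norm (\<lambda>x. indicator {..<a} x - g x))\<^sup>2 < \<epsilon>"
      by (intro exI conjI)
  qed
qed

text \<open>
  The sets with approximable indicator form a Dynkin system, and half-lines are an
  intersection-stable generator of the Borel sets.
\<close>

lemma indicator_approximable:
  assumes "B \<in> sets borel"
  shows "trig_approximable (indicator B)"
proof -
  have L2: "(indicator A :: real \<Rightarrow> complex) \<in> L2_torus" if "A \<in> sets borel" for A
    by (rule L2I_bounded[where B=1]) (use that in \<open>auto intro: borel_measurable_torusI split: split_indicator\<close>)
  have borel: "sigma_sets UNIV (range lessThan) = sets (borel :: real measure)"
    unfolding borel_Iio by simp
  have "Int_stable (range (lessThan :: real \<Rightarrow> real set))"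
    by (auto simp: Int_stable_def intro: image_eqI[where x="min _ _"])
  moreover have "range lessThan \<subseteq> Pow (UNIV :: real set)" by simp
  moreover have "B \<in> sigma_sets UNIV (range lessThan)"
    using assms borel by simp
  ultimately show ?thesis
  proof (induct rule: sigma_sets_induct_disjoint)
    case (basic A)
    then show ?case by (auto intro: indicator_lessThan_approximable)
  next
    case empty
    then show ?case by (simp add: trig_approximable_zero)
  next
    case (compl A)
    have "(indicator (UNIV - A) :: real \<Rightarrow> complex) = (\<lambda>x. 1 + (-1) * indicator A x)"
      by (auto simp: fun_eq_iff split: split_indicator)
    then show ?case
      using trig_approximable_add[OF trig_approximable_one trig_approximable_cmult[OF compl(2), of "-1"]] by simp
  next
    case (union A)
    then have A: "A i \<in> sets borel" for i unfolding borel by auto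
    have s: "trig_approximable (\<lambda>x. \<Sum>i<n. indicator (A i) x)" for n
      by (rule trig_approximable_sum) (rule union)
    have eq: "(\<Sum>i<n. indicator (A i) x :: complex) = indicator (\<Union>i<n. A i) x" for n x
      using union(1) by (subst indicator_UN_disjoint) (auto intro: disjoint_family_on_mono)
    show ?case
    proof (rule trig_approximable_dominated_limit[OF _ s])
      show "(\<lambda>n. \<Sum>i<n. indicator (A i) x :: complex) \<longlonglongrightarrow> indicator (\<Union>i. A i) x" for x
        unfolding eq by (rule LIMSEQ_indicator_UN)
      show "(cmod (indicator (\<Union>i. A i) x - (\<Sum>i<n. indicator (A i) x)))\<^sup>2 \<le> 1" for n x
        unfolding eq by (auto split: split_indicator)
      show "(indicator (\<Union>i. A i) :: real \<Rightarrow> complex) \<in> L2_torus"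
        using L2 A by auto
    qed simp
  qed
qed

text \<open>
  Simple functions dominated by \<open>2 |f|\<close> converge to \<open>f\<close> in \<open>L\<^sup>2\<close> by dominated convergence.
\<close>

theorem L2_approximable:
  assumes f: "f \<in> L2_torus"
  shows "trig_approximable f"
proof -
  obtain s where s: "\<forall>i. simple_function torus (s i)"
    and lim: "\<forall>x\<in>space torus. (\<lambda>i. s i x) \<longlonglongrightarrow> f x"
    and bound: "\<forall>i. \<forall>x\<in>space torus. dist (s i x) 0 \<le> 2 * dist (f x) 0"
    using borel_measurable_implies_sequence_metric[OF L2_measurable[OF f], of 0] by blast
  let ?t = "\<lambda>i x. \<Sum>y\<in>s i ` space torus. y * indicator (s i -` {y} \<inter> space torus) x"
  have t: "trig_approximable (?t i)" for i
  proof (intro trig_approximable_sum trig_approximable_cmult indicator_approximable)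
    fix y
    have "s i -` {y} \<inter> space torus \<in> sets torus"
      using spec[OF s, of i] by (rule simple_functionD)
    then show "s i -` {y} \<inter> space torus \<in> sets borel"
      using in_sets_torusD by blast
  qed
  have eq: "?t i x = s i x" if x: "x \<in> space torus" for i x
  proof -
    have "?t i x = (\<Sum>y\<in>s i ` space torus. if y = s i x then y else 0)"
      by (rule sum.cong) (use x in \<open>auto split: split_indicator\<close>)
    also have "\<dots> = s i x"
      using simple_functionD(1)[OF spec[OF s, of i]] x by (subst sum.delta) auto
    finally show ?thesis .
  qed
  show ?thesis
  proof (rule trig_approximable_dominated_limit[OF f t])
    show "(\<lambda>i. ?t i x) \<longlonglongrightarrow> f x" if "x \<in> {0..<2*pi}" for x
      using lim eq that by simp
    show "integrable torus (\<lambda>x. 9 * (cmod (f x))\<^sup>2)"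
      using L2_square_integrable[OF f] by simp
    show "(cmod (f x - ?t i x))\<^sup>2 \<le> 9 * (cmod (f x))\<^sup>2" if "x \<in> {0..<2*pi}" for i x
    proof -
      have x: "x \<in> space torus" using that by simp
      have "cmod (f x - ?t i x) \<le> cmod (f x) + cmod (s i x)"
        unfolding eq[OF x] by (rule norm_triangle_ineq4)
      also have "\<dots> \<le> 3 * cmod (f x)" using bspec[OF spec[OF bound, of i] x] by simp
      finally have "(cmod (f x - ?t i x))\<^sup>2 \<le> (3 * cmod (f x))\<^sup>2" by (rule power_mono) simp
      then show ?thesis by (simp add: power_mult_distrib)
    qed
  qed
qed

theorem Parseval:
  assumes f: "f \<in> L2_torus"
  shows "((\<lambda>k. (cmod (fourier_coeff f k))\<^sup>2) has_sum (L2_norm f)\<^sup>2) UNIV"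
  unfolding has_sum_def
proof (rule order_tendstoI)
  fix y assume "y < (L2_norm f)\<^sup>2"
  then have "(L2_norm f)\<^sup>2 - y > 0" by simp
  then obtain F where F: "finite F" "(L2_norm f)\<^sup>2 - (\<Sum>k\<in>F. (cmod (fourier_coeff f k))\<^sup>2) < (L2_norm f)\<^sup>2 - y"
    using L2_approximable[OF f] unfolding trig_approximable_iff[OF f] by blast
  show "\<forall>\<^sub>F F in finite_subsets_at_top UNIV. y < (\<Sum>k\<in>F. (cmod (fourier_coeff f k))\<^sup>2)"
    unfolding eventually_finite_subsets_at_top
  proof (intro exI[of _ F] conjI allI impI)
    fix G assume G: "finite G \<and> F \<subseteq> G \<and> G \<subseteq> (UNIV :: int set)"
    then have "(\<Sum>k\<in>F. (cmod (fourier_coeff f k))\<^sup>2) \<le> (\<Sum>k\<in>G. (cmod (fourier_coeff f k))\<^sup>2)"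
      by (intro sum_mono2) auto
    with F show "y < (\<Sum>k\<in>G. (cmod (fourier_coeff f k))\<^sup>2)" by linarith
  qed (use F in auto)
next
  fix y assume y: "(L2_norm f)\<^sup>2 < y"
  show "\<forall>\<^sub>F F in finite_subsets_at_top UNIV. (\<Sum>k\<in>F. (cmod (fourier_coeff f k))\<^sup>2) < y"
    by (rule eventually_finite_subsets_at_top_weakI) (rule le_less_trans[OF Bessel[OF f] y])
qed

section \<open>Absolutely convergent sums over the integers\<close>

lemma has_sum_finite_sum:
  fixes f :: "'i \<Rightarrow> 'a \<Rightarrow> 'b::topological_comm_monoid_add"
  assumes "\<And>i. i \<in> L \<Longrightarrow> (f i has_sum s i) A"
  shows "((\<lambda>x. \<Sum>i\<in>L. f i x) has_sum (\<Sum>i\<in>L. s i)) A"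
  using assms by (induct L rule: infinite_finite_induct) (auto intro: has_sum_add)

lemma has_sum_diff:
  fixes f g :: "'a \<Rightarrow> 'b::topological_ab_group_add"
  assumes "(f has_sum a) A" "(g has_sum b) A"
  shows "((\<lambda>x. f x - g x) has_sum (a - b)) A"
  using has_sum_add[OF assms(1), of "\<lambda>x. - g x" "- b"] assms(2) by (simp add: has_sum_uminus)

text \<open>
  The substitute for Young's inequality for the convolution of an \<open>\<ell>\<^sup>1\<close> and an \<open>\<ell>\<^sup>2\<close> sequence: the
  weight is split evenly between the two factors, so that squares of \<open>z\<close> are weighted by \<open>d\<close> once.
\<close>

lemma weighted_Cauchy_Schwarz_has_sum:
  fixes u z :: "'a \<Rightarrow> complex" and d :: "'a \<Rightarrow> real"
  assumes s: "((\<lambda>k. u k * z k) has_sum s) A"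
    and u: "\<And>k. k \<in> A \<Longrightarrow> cmod (u k) \<le> d k"
    and d: "(d has_sum D) A" and t: "((\<lambda>k. d k * (cmod (z k))\<^sup>2) has_sum T) A"
  shows "(cmod s)\<^sup>2 \<le> D * T"
proof -
  have d0: "0 \<le> d k" if "k \<in> A" for k
    using u[OF that] norm_ge_zero[of "u k"] by linarith
  have fin: "(cmod (\<Sum>k\<in>F. u k * z k))\<^sup>2 \<le> D * T" if F: "finite F" "F \<subseteq> A" for F
  proof -
    have "cmod (\<Sum>k\<in>F. u k * z k) \<le> (\<Sum>k\<in>F. sqrt (d k) * (sqrt (d k) * cmod (z k)))"
    proof (rule sum_norm_le)
      fix k assume "k \<in> F"
      then have k: "k \<in> A" using F by auto
      have "sqrt (d k) * (sqrt (d k) * cmod (z k)) = d k * cmod (z k)"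
        using d0[OF k] by (simp add: mult.assoc[symmetric])
      moreover have "norm (u k * z k) \<le> d k * cmod (z k)"
        using u[OF k] by (simp add: norm_mult mult_right_mono)
      ultimately show "norm (u k * z k) \<le> sqrt (d k) * (sqrt (d k) * cmod (z k))"
        by (simp only:)
    qed
    then have "(cmod (\<Sum>k\<in>F. u k * z k))\<^sup>2 \<le> (\<Sum>k\<in>F. sqrt (d k) * (sqrt (d k) * cmod (z k)))\<^sup>2"
      by (rule power_mono) simp
    also have "\<dots> \<le> (\<Sum>k\<in>F. (sqrt (d k))\<^sup>2) * (\<Sum>k\<in>F. (sqrt (d k) * cmod (z k))\<^sup>2)"
      by (rule Cauchy_Schwarz_ineq_sum)
    also have "\<dots> = (\<Sum>k\<in>F. d k) * (\<Sum>k\<in>F. d k * (cmod (z k))\<^sup>2)"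
      using d0 F by (intro arg_cong2[where f="(*)"] sum.cong) (auto simp: power_mult_distrib)
    also have "\<dots> \<le> D * T"
    proof (rule mult_mono)
      show "sum d F \<le> D"
        by (rule finite_sum_le_has_sum[OF d]) (use F d0 in auto)
      show "(\<Sum>k\<in>F. d k * (cmod (z k))\<^sup>2) \<le> T"
        by (rule finite_sum_le_has_sum[OF t]) (use F d0 in auto)
      show "0 \<le> D" by (rule has_sum_nonneg[OF d d0])
      show "0 \<le> (\<Sum>k\<in>F. d k * (cmod (z k))\<^sup>2)" by (rule sum_nonneg) (use F d0 in auto)
    qed
    finally show ?thesis .
  qed
  have "((\<lambda>F. (cmod (\<Sum>k\<in>F. u k * z k))\<^sup>2) \<longlongrightarrow> (cmod s)\<^sup>2) (finite_subsets_at_top A)"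
    using s unfolding has_sum_def by (intro tendsto_power tendsto_norm)
  then show ?thesis
    by (rule tendsto_upperbound) (auto intro!: eventually_finite_subsets_at_top_weakI fin)
qed

lemma summable_on_mult_bounded:
  fixes d h :: "'a \<Rightarrow> real"
  assumes "d summable_on A" "\<And>k. k \<in> A \<Longrightarrow> 0 \<le> d k" "\<And>k. k \<in> A \<Longrightarrow> 0 \<le> h k" "\<And>k. k \<in> A \<Longrightarrow> h k \<le> B"
  shows "(\<lambda>k. d k * h k) summable_on A"
proof (rule summable_on_comparison_test)
  show "(\<lambda>k. d k * B) summable_on A" by (rule summable_on_cmult_left[OF assms(1)])
qed (use assms in \<open>auto intro: mult_left_mono\<close>)

text \<open>
  Bounds for \<open>\<ell>\<^sup>2\<close> norms only need finite outer sums; these may be moved inside without any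
  interchange of infinite sums.
\<close>

lemma finite_sum_weighted_infsum_le:
  fixes d :: "'a \<Rightarrow> real"
  assumes d: "d summable_on A" "\<And>k. k \<in> A \<Longrightarrow> 0 \<le> d k"
    and h: "\<And>k n. k \<in> A \<Longrightarrow> n \<in> L \<Longrightarrow> 0 \<le> h k n" "\<And>k. k \<in> A \<Longrightarrow> (\<Sum>n\<in>L. h k n) \<le> B k"
    and B: "\<And>k. k \<in> A \<Longrightarrow> B k \<le> b" and fin: "finite L"
  shows "(\<Sum>n\<in>L. \<Sum>\<^sub>\<infinity>k\<in>A. d k * h k n) \<le> (\<Sum>\<^sub>\<infinity>k\<in>A. d k * B k)"
proof -
  have hb: "h k n \<le> b" if "k \<in> A" "n \<in> L" for k n
  proof -
    have "h k n \<le> (\<Sum>n\<in>L. h k n)"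
      using that h(1) fin by (intro member_le_sum) auto
    also have "\<dots> \<le> b" using h(2) B that by force
    finally show ?thesis .
  qed
  have "((\<lambda>k. \<Sum>n\<in>L. d k * h k n) has_sum (\<Sum>n\<in>L. \<Sum>\<^sub>\<infinity>k\<in>A. d k * h k n)) A"
    by (rule has_sum_finite_sum)
      (rule has_sum_infsum, rule summable_on_mult_bounded[OF d], use h hb in auto)
  moreover have "((\<lambda>k. d k * B k) has_sum (\<Sum>\<^sub>\<infinity>k\<in>A. d k * B k)) A"
  proof (rule has_sum_infsum, rule summable_on_mult_bounded[OF d])
    show "0 \<le> B k" if "k \<in> A" for k
      using h(2)[OF that] sum_nonneg[of L "h k"] h(1)[OF that] by fastforce
  qed (use B in auto)
  ultimately show ?thesis
    by (rule has_sum_mono) (use d h in \<open>auto simp: sum_distrib_left[symmetric] intro: mult_left_mono\<close>)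
qed

lemma summable_on_tail_small:
  fixes q :: "'a \<Rightarrow> real"
  assumes q: "q summable_on UNIV" and nonneg: "\<And>n. 0 \<le> q n" and "\<epsilon> > 0"
  obtains F where "finite F" "\<And>G. finite G \<Longrightarrow> G \<inter> F = {} \<Longrightarrow> sum q G < \<epsilon>"
proof -
  obtain s where s: "(q has_sum s) UNIV" using q by (auto simp: summable_on_def)
  then have "\<forall>\<^sub>F F in finite_subsets_at_top UNIV. sum q F > s - \<epsilon>"
    unfolding has_sum_def by (rule order_tendstoD) (use \<open>\<epsilon> > 0\<close> in simp)
  then obtain F where F: "finite F" "sum q F > s - \<epsilon>"
    by (auto simp: eventually_finite_subsets_at_top)
  show thesis
  proof (rule that[OF F(1)])
    fix G assume G: "finite G" "G \<inter> F = {}"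
    have "sum q G + sum q F = sum q (G \<union> F)"
      using G F by (simp add: sum.union_disjoint)
    also have "\<dots> \<le> s"
      by (rule finite_sum_le_has_sum[OF s]) (use G F nonneg in auto)
    finally show "sum q G < \<epsilon>" using F(2) by simp
  qed
qed

lemma summable_on_int_tail_small:
  fixes q :: "int \<Rightarrow> real"
  assumes q: "q summable_on UNIV" and nonneg: "\<And>n. 0 \<le> q n" and "\<epsilon> > 0"
  obtains M :: nat where "\<And>G. finite G \<Longrightarrow> (\<And>n. n \<in> G \<Longrightarrow> \<bar>n\<bar> > int M) \<Longrightarrow> sum q G < \<epsilon>"
proof -
  obtain F where F: "finite F" "\<And>G. finite G \<Longrightarrow> G \<inter> F = {} \<Longrightarrow> sum q G < \<epsilon>"
    using summable_on_tail_small[OF assms] by blast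
  define M where "M = nat (Max (insert 0 (abs ` F)))"
  have M: "\<bar>n\<bar> \<le> int M" if "n \<in> F" for n
  proof -
    have "\<bar>n\<bar> \<le> Max (insert 0 (abs ` F))" by (rule Max_ge) (use F that in auto)
    moreover have "0 \<le> Max (insert 0 (abs ` F))" by (rule Max_ge) (use F in auto)
    ultimately show ?thesis unfolding M_def by linarith
  qed
  show thesis
    by (rule that[of M], rule F(2)) (use M in force)+
qed

lemma bij_minus_int: "bij_betw (\<lambda>j. l - j) UNIV (UNIV :: int set)"
  by (rule bij_betwI[where g="\<lambda>j. l - j"]) auto

lemma has_sum_reflect_int: "(f has_sum s) UNIV \<Longrightarrow> ((\<lambda>j::int. f (l - j)) has_sum s) UNIV"
  using has_sum_reindex_bij_betw[OF bij_minus_int, of f l s] by simp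

section \<open>Rows of an operator of diagonal type\<close>

locale diagonal_type_operator =
  fixes W :: operator
  assumes diagonal: "W \<in> diagonal_type"
begin

abbreviation "w \<equiv> mat_entry W"
abbreviation "c \<equiv> diag_sup W"

text \<open>The norm of \<open>W\<close> as an operator of diagonal type.\<close>

definition "C = (\<Sum>\<^sub>\<infinity>k. c k)"

lemma bounded: "bounded_operator W"
  using diagonal by (simp add: diagonal_type_def)

lemma W_L2: "f \<in> L2_torus \<Longrightarrow> W f \<in> L2_torus"
  using bounded by (simp add: bounded_operator_def)

lemma W_bound: obtains K where "0 \<le> K" "\<And>f. f \<in> L2_torus \<Longrightarrow> L2_norm (W f) \<le> K * L2_norm f"
proof -
  obtain K where K: "\<forall>f\<in>L2_torus. L2_norm (W f) \<le> K * L2_norm f"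
    using bounded unfolding bounded_operator_def by blast
  show thesis
  proof (rule that[of "max K 0"])
    fix f assume "f \<in> L2_torus"
    then have "L2_norm (W f) \<le> K * L2_norm f" using K by blast
    also have "\<dots> \<le> max K 0 * L2_norm f" by (intro mult_right_mono L2_norm_nonneg) simp
    finally show "L2_norm (W f) \<le> max K 0 * L2_norm f" .
  qed simp
qed

lemma coeff_W_add:
  assumes "f \<in> L2_torus" "g \<in> L2_torus"
  shows "fourier_coeff (W (\<lambda>x. f x + g x)) l = fourier_coeff (W f) l + fourier_coeff (W g) l"
proof -
  have "fourier_coeff (W (\<lambda>x. f x + g x)) l = fourier_coeff (\<lambda>x. W f x + W g x) l"
    by (rule fourier_coeff_cong)
      (use bounded assms in \<open>auto simp: bounded_operator_def intro!: L2_measurable L2_add\<close>)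
  then show ?thesis by (simp add: fourier_coeff_add W_L2 assms)
qed

lemma coeff_W_cmult:
  assumes "f \<in> L2_torus"
  shows "fourier_coeff (W (\<lambda>x. a * f x)) l = a * fourier_coeff (W f) l"
proof -
  have "fourier_coeff (W (\<lambda>x. a * f x)) l = fourier_coeff (\<lambda>x. a * W f x) l"
    by (rule fourier_coeff_cong)
      (use bounded assms in \<open>auto simp: bounded_operator_def intro!: L2_measurable L2_cmult\<close>)
  then show ?thesis by (simp add: fourier_coeff_cmult)
qed

lemma norm_W_cmult:
  assumes "f \<in> L2_torus"
  shows "L2_norm (W (\<lambda>x. a * f x)) = cmod a * L2_norm (W f)"
proof -
  have "L2_norm (W (\<lambda>x. a * f x)) = L2_norm (\<lambda>x. a * W f x)"
    by (rule L2_norm_cong)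
      (use bounded assms in \<open>auto simp: bounded_operator_def intro!: L2_measurable L2_cmult\<close>)
  then show ?thesis by (simp add: L2_norm_cmult)
qed

lemma coeff_W_trig_sum:
  "fourier_coeff (W (\<lambda>x. \<Sum>k\<in>F. a k * fourier_mode k x)) l = (\<Sum>k\<in>F. a k * w l k)"
proof (induct F rule: infinite_finite_induct)
  case (insert k F)
  then show ?case
    by (simp add: coeff_W_add L2_trig_sum L2_cmult L2_fourier_mode coeff_W_cmult mat_entry_def)
next
  case empty
  show ?case using coeff_W_cmult[OF L2_zero, of 0] by simp
next
  case (infinite F)
  then show ?case using coeff_W_cmult[OF L2_zero, of 0] by simp
qed

text \<open>
  The partial sums of the Fourier series converge in \<open>L\<^sup>2\<close> by Parseval's identity, and a fixed
  Fourier coefficient of \<open>W f\<close> depends on \<open>f\<close> linearly and continuously.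
\<close>

lemma coeff_W_has_sum:
  assumes f: "f \<in> L2_torus"
  shows "((\<lambda>k. w l k * fourier_coeff f k) has_sum fourier_coeff (W f) l) UNIV"
proof -
  obtain K where K: "0 \<le> K" "\<And>f. f \<in> L2_torus \<Longrightarrow> L2_norm (W f) \<le> K * L2_norm f"
    using W_bound by blast
  let ?S = "\<lambda>F x. \<Sum>k\<in>F. fourier_coeff f k * fourier_mode k x"
  let ?R = "\<lambda>F. L2_norm (\<lambda>x. f x - ?S F x)"
  have est: "cmod ((\<Sum>k\<in>F. w l k * fourier_coeff f k) - fourier_coeff (W f) l) \<le> K * ?R F" for F
  proof -
    have d: "(\<lambda>x. f x - ?S F x) \<in> L2_torus" by (intro L2_diff f L2_trig_sum)
    have "fourier_coeff (W (\<lambda>x. (f x - ?S F x) + ?S F x)) l =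
        fourier_coeff (W (\<lambda>x. f x - ?S F x)) l + (\<Sum>k\<in>F. fourier_coeff f k * w l k)"
      unfolding coeff_W_add[OF d L2_trig_sum] coeff_W_trig_sum ..
    then have "fourier_coeff (W f) l = fourier_coeff (W (\<lambda>x. f x - ?S F x)) l + (\<Sum>k\<in>F. fourier_coeff f k * w l k)"
      by simp
    then have "cmod ((\<Sum>k\<in>F. w l k * fourier_coeff f k) - fourier_coeff (W f) l)
        = cmod (fourier_coeff (W (\<lambda>x. f x - ?S F x)) l)"
      by (simp add: mult.commute)
    also have "\<dots> \<le> L2_norm (W (\<lambda>x. f x - ?S F x))" by (rule norm_fourier_coeff_le[OF W_L2[OF d]])
    also have "\<dots> \<le> K * ?R F" by (rule K(2)[OF d])
    finally show ?thesis .
  qed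
  have "((\<lambda>F. sqrt ((L2_norm f)\<^sup>2 - (\<Sum>k\<in>F. (cmod (fourier_coeff f k))\<^sup>2)))
      \<longlongrightarrow> sqrt ((L2_norm f)\<^sup>2 - (L2_norm f)\<^sup>2)) (finite_subsets_at_top UNIV)"
    using Parseval[OF f] unfolding has_sum_def by (intro tendsto_real_sqrt tendsto_diff tendsto_const)
  then have lim: "((\<lambda>F. K * sqrt ((L2_norm f)\<^sup>2 - (\<Sum>k\<in>F. (cmod (fourier_coeff f k))\<^sup>2))) \<longlongrightarrow> 0)
      (finite_subsets_at_top UNIV)"
    by (intro tendsto_mult_right_zero) simp
  have "((\<lambda>F. (\<Sum>k\<in>F. w l k * fourier_coeff f k) - fourier_coeff (W f) l) \<longlongrightarrow> 0) (finite_subsets_at_top UNIV)"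
  proof (rule Lim_null_comparison[OF _ lim], rule eventually_finite_subsets_at_top_weakI)
    fix F :: "int set" assume F: "finite F"
    have "(?R F)\<^sup>2 = (L2_norm f)\<^sup>2 - (\<Sum>k\<in>F. (cmod (fourier_coeff f k))\<^sup>2)"
      using L2_norm_sq_diff_trig_sum[OF f F, of "fourier_coeff f"] by simp
    then have "?R F = sqrt ((L2_norm f)\<^sup>2 - (\<Sum>k\<in>F. (cmod (fourier_coeff f k))\<^sup>2))"
      by (intro real_sqrt_unique[OF _ L2_norm_nonneg, symmetric])
    then show "norm ((\<Sum>k\<in>F. w l k * fourier_coeff f k) - fourier_coeff (W f) l)
        \<le> K * sqrt ((L2_norm f)\<^sup>2 - (\<Sum>k\<in>F. (cmod (fourier_coeff f k))\<^sup>2))"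
      using est[of F] by simp
  qed
  then show ?thesis unfolding has_sum_def by (rule LIM_zero_cancel)
qed

lemma entry_le: "cmod (w l j) \<le> c (l - j)"
proof -
  have "cmod (w (j + (l - j)) j) \<le> c (l - j)"
    unfolding diag_sup_def by (rule cSUP_upper) (use diagonal in \<open>auto simp: diagonal_type_def\<close>)
  then show ?thesis by simp
qed

lemma c_nonneg: "0 \<le> c k"
  using order_trans[OF norm_ge_zero entry_le[of k 0]] by simp

lemma c_summable: "c summable_on UNIV"
  using diagonal by (simp add: diagonal_type_def)

lemma c_has_sum: "(c has_sum C) UNIV"
  unfolding C_def by (rule has_sum_infsum[OF c_summable])

lemma C_nonneg: "0 \<le> C"
  by (rule has_sum_nonneg[OF c_has_sum]) (rule c_nonneg)

lemma row_c_has_sum: "((\<lambda>j. c (l - j)) has_sum C) UNIV"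
  by (rule has_sum_reflect_int[OF c_has_sum])

text \<open>
  The function \<open>H\<^sub>l\<close>. The modes carry negative frequencies so that integration
  against it, without conjugation, gives the \<open>l\<close>-th Fourier coefficient of \<open>W f\<close>.
\<close>

definition row :: "int \<Rightarrow> real \<Rightarrow> complex" where
  "row l x = (\<Sum>\<^sub>\<infinity>j. w l j * fourier_mode (- j) x)"

lemma row_abs_summable: "(\<lambda>j. norm (w l j * fourier_mode (- j) x)) summable_on UNIV"
  by (rule summable_on_comparison_test[OF has_sum_imp_summable[OF row_c_has_sum[of l]]])
    (auto simp: norm_mult entry_le)

lemma row_has_sum: "((\<lambda>j. w l j * fourier_mode (- j) x) has_sum row l x) UNIV"
  unfolding row_def by (rule has_sum_infsum[OF abs_summable_summable[OF row_abs_summable]])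

lemma row_norm_le: "cmod (row l x) \<le> C"
proof -
  have "cmod (row l x) \<le> (\<Sum>\<^sub>\<infinity>j. c (l - j))"
    unfolding row_def
    by (rule norm_infsum_le[OF has_sum_infsum has_sum_infsum])
      (auto simp: norm_mult entry_le abs_summable_summable[OF row_abs_summable] has_sum_imp_summable[OF row_c_has_sum])
  then show ?thesis using infsumI[OF row_c_has_sum] by simp
qed

lemma row_uniform_limit:
  "uniform_limit UNIV (\<lambda>F x. \<Sum>j\<in>F. w l j * fourier_mode (- j) x) (row l) (finite_subsets_at_top UNIV)"
  unfolding row_def
  by (rule Weierstrass_m_test_general[OF _ has_sum_imp_summable[OF row_c_has_sum[of l]]])
    (simp add: norm_mult entry_le)

lemma row_measurable: "row l \<in> borel_measurable torus"
proof (rule borel_measurable_torusI, rule borel_measurable_continuous_onI)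
  show "continuous_on UNIV (row l)"
    by (rule uniform_limit_theorem[OF _ row_uniform_limit])
      (auto intro!: always_eventually continuous_intros continuous_on_fourier_mode)
qed

lemma row_L2: "row l \<in> L2_torus"
  by (rule L2I_bounded[OF row_measurable row_norm_le])

text \<open>
  Both sides are limits of the same finite sums: the series of the row function converges
  uniformly, and \<open>f\<close> is integrable because the circle has finite measure.
\<close>

lemma coeff_W_eq_integral_row:
  assumes f: "f \<in> L2_torus"
  shows "fourier_coeff (W f) l = (LINT x|torus. row l x * f x)"
proof -
  have int: "integrable torus (\<lambda>x. cmod (f x))"
    using L2_integrable_product[OF L2_fourier_mode[of 0] f] by simp
  define A where "A = (LINT x|torus. cmod (f x))"
  have A: "0 \<le> A" unfolding A_def by simp
  have part: "(\<Sum>j\<in>F. w l j * fourier_coeff f j) = (LINT x|torus. (\<Sum>j\<in>F. w l j * fourier_mode (- j) x) * f x)" for F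
  proof -
    have "(LINT x|torus. (\<Sum>j\<in>F. w l j * fourier_mode (- j) x) * f x)
        = (LINT x|torus. (\<Sum>j\<in>F. w l j * (cnj (fourier_mode j x) * f x)))"
      by (simp add: sum_distrib_right cnj_fourier_mode mult.assoc)
    also have "\<dots> = (\<Sum>j\<in>F. w l j * fourier_coeff f j)"
      unfolding fourier_coeff_def using L2_integrable_coeff[OF f]
      by (subst Bochner_Integration.integral_sum) auto
    finally show ?thesis by simp
  qed
  have "((\<lambda>F. \<Sum>j\<in>F. w l j * fourier_coeff f j) \<longlongrightarrow> (LINT x|torus. row l x * f x)) (finite_subsets_at_top UNIV)"
  proof (rule tendstoI)
    fix e :: real assume "e > 0"
    then have "e / (A + 1) > 0" using A by simp
    from uniform_limitD[OF row_uniform_limit this]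
    show "\<forall>\<^sub>F F in finite_subsets_at_top UNIV. dist (\<Sum>j\<in>F. w l j * fourier_coeff f j) (LINT x|torus. row l x * f x) < e"
    proof (rule eventually_mono)
      fix F assume elim: "\<forall>x\<in>UNIV. dist (\<Sum>j\<in>F. w l j * fourier_mode (- j) x) (row l x) < e / (A + 1)"
      let ?p = "\<lambda>x. \<Sum>j\<in>F. w l j * fourier_mode (- j) x"
      have p: "?p \<in> L2_torus" by (intro L2_sum L2_cmult L2_fourier_mode)
      have "dist (\<Sum>j\<in>F. w l j * fourier_coeff f j) (LINT x|torus. row l x * f x)
          = cmod (LINT x|torus. ?p x * f x - row l x * f x)"
        unfolding part dist_norm
        by (subst Bochner_Integration.integral_diff) (auto intro: L2_integrable_product p f row_L2)
      also have "\<dots> \<le> (LINT x|torus. cmod (?p x * f x - row l x * f x))"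
        by (rule integral_norm_bound)
      also have "\<dots> \<le> (LINT x|torus. e / (A + 1) * cmod (f x))"
      proof (rule integral_mono)
        show "integrable torus (\<lambda>x. cmod (?p x * f x - row l x * f x))"
          by (intro integrable_norm Bochner_Integration.integrable_diff L2_integrable_product p f row_L2)
        show "cmod (?p x * f x - row l x * f x) \<le> e / (A + 1) * cmod (f x)" for x
          using elim unfolding left_diff_distrib[symmetric] norm_mult
          by (intro mult_right_mono) (auto simp: dist_norm intro: less_imp_le)
      qed (use int in simp)
      also have "\<dots> = e * (A / (A + 1))" by (simp add: A_def)
      also have "\<dots> < e" using A \<open>e > 0\<close> by (simp add: field_simps)
      finally show "dist (\<Sum>j\<in>F. w l j * fourier_coeff f j) (LINT x|torus. row l x * f x) < e" .
    qed
  qed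
  moreover have "((\<lambda>F. \<Sum>j\<in>F. w l j * fourier_coeff f j) \<longlongrightarrow> fourier_coeff (W f) l) (finite_subsets_at_top UNIV)"
    using coeff_W_has_sum[OF f] by (simp add: has_sum_def)
  ultimately show ?thesis
    by (intro tendsto_unique[OF finite_subsets_at_top_neq_bot])
qed

text \<open>
  The row function of \<open>W \<pi>\<^sub>Y\<close> is the restriction of that of \<open>W\<close> to \<open>Y\<close>; Parseval's identity
  turns its squared norm into the sum over the row.
\<close>

lemma row_localized_has_sum:
  assumes Y: "Y \<in> sets torus"
  shows "((\<lambda>j. (cmod (fourier_coeff (W (cutoff Y (fourier_mode j))) l))\<^sup>2) has_sum
    (LINT x|torus. indicator Y x * (cmod (row l x))\<^sup>2)) UNIV"
proof -
  have "fourier_coeff (W (cutoff Y (fourier_mode j))) l = fourier_coeff (cutoff Y (row l)) (0 - j)" for j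
    unfolding coeff_W_eq_integral_row[OF cutoff_L2[OF Y L2_fourier_mode]]
    by (simp add: fourier_coeff_def cutoff_def cnj_fourier_mode mult_ac)
  moreover have "(L2_norm (cutoff Y (row l)))\<^sup>2 = (LINT x|torus. indicator Y x * (cmod (row l x))\<^sup>2)"
    unfolding L2_norm_sq cutoff_def
    by (rule Bochner_Integration.integral_cong) (auto split: split_indicator)
  ultimately show ?thesis
    using has_sum_reflect_int[OF Parseval[OF cutoff_L2[OF Y row_L2[of l]]], where l=0] by simp
qed

lemma row_norm_has_sum: "((\<lambda>j. (cmod (w l j))\<^sup>2) has_sum (L2_norm (row l))\<^sup>2) UNIV"
proof -
  have "w l j = fourier_coeff (row l) (0 - j)" for j
    unfolding mat_entry_def coeff_W_eq_integral_row[OF L2_fourier_mode]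
    by (simp add: fourier_coeff_def cnj_fourier_mode mult_ac)
  then show ?thesis
    using has_sum_reflect_int[OF Parseval[OF row_L2[of l]], where l=0] by simp
qed

section \<open>Localized operator norms\<close>

lemma op_norm_cutoff_ball:
  assumes Y: "Y \<in> sets torus" and f: "f \<in> L2_torus" "L2_norm f \<le> 1"
  shows "L2_norm (W (cutoff Y f)) \<le> op_norm (W \<circ> cutoff Y)"
  unfolding op_norm_def
proof (rule cSup_upper)
  show "L2_norm (W (cutoff Y f)) \<in> {L2_norm ((W \<circ> cutoff Y) f) |f. f \<in> L2_torus \<and> L2_norm f \<le> 1}"
    using f by auto
  obtain K where K: "0 \<le> K" "\<And>f. f \<in> L2_torus \<Longrightarrow> L2_norm (W f) \<le> K * L2_norm f"
    using W_bound by blast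
  show "bdd_above {L2_norm ((W \<circ> cutoff Y) f) |f. f \<in> L2_torus \<and> L2_norm f \<le> 1}"
  proof (rule bdd_aboveI[of _ K])
    fix r assume "r \<in> {L2_norm ((W \<circ> cutoff Y) f) |f. f \<in> L2_torus \<and> L2_norm f \<le> 1}"
    then obtain f where f: "f \<in> L2_torus" "L2_norm f \<le> 1" "r = L2_norm (W (cutoff Y f))" by auto
    have "L2_norm (cutoff Y f) \<le> L2_norm f"
      by (rule power2_le_imp_le[OF L2_norm_cutoff_sq_le[OF Y f(1)] L2_norm_nonneg])
    then have "K * L2_norm (cutoff Y f) \<le> K * 1"
      using f(2) K(1) by (intro mult_left_mono) auto
    then show "r \<le> K" using K(2)[OF cutoff_L2[OF Y f(1)]] f(3) by simp
  qed
qed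

lemma op_norm_cutoff_nonneg:
  assumes "Y \<in> sets torus"
  shows "0 \<le> op_norm (W \<circ> cutoff Y)"
  using order_trans[OF L2_norm_nonneg op_norm_cutoff_ball[OF assms L2_zero]] by (simp add: L2_norm_def)

lemma op_norm_cutoff_sq_le:
  assumes Y: "Y \<in> sets torus"
    and B: "\<And>f. f \<in> L2_torus \<Longrightarrow> L2_norm f \<le> 1 \<Longrightarrow> (L2_norm (W (cutoff Y f)))\<^sup>2 \<le> B"
  shows "(op_norm (W \<circ> cutoff Y))\<^sup>2 \<le> B"
proof -
  have "op_norm (W \<circ> cutoff Y) \<le> sqrt B"
    unfolding op_norm_def
  proof (rule cSup_least)
    have "(\<lambda>x. 0) \<in> L2_torus \<and> L2_norm (\<lambda>x. 0) \<le> 1" by (simp add: L2_zero L2_norm_def)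
    then show "{L2_norm ((W \<circ> cutoff Y) f) |f. f \<in> L2_torus \<and> L2_norm f \<le> 1} \<noteq> {}" by blast
  qed (use B real_le_rsqrt in auto)
  moreover have "0 \<le> B"
    using order_trans[OF zero_le_power2 B[OF L2_zero]] by (simp add: L2_norm_def)
  ultimately show ?thesis
    using power_mono[OF _ op_norm_cutoff_nonneg[OF Y], of "sqrt B" 2] by simp
qed

text \<open>
  A function of norm zero cannot be rescaled into the unit sphere; for it the boundedness of \<open>W\<close>
  shows that the left-hand side vanishes.
\<close>

lemma op_norm_cutoff_bound:
  assumes Y: "Y \<in> sets torus" and f: "f \<in> L2_torus"
  shows "L2_norm (W (cutoff Y f)) \<le> op_norm (W \<circ> cutoff Y) * L2_norm f"
proof (cases "L2_norm f = 0")
  case True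
  obtain K where K: "0 \<le> K" "\<And>f. f \<in> L2_torus \<Longrightarrow> L2_norm (W f) \<le> K * L2_norm f"
    using W_bound by blast
  have "L2_norm (cutoff Y f) = 0"
    using L2_norm_cutoff_sq_le[OF Y f] True by simp
  then show ?thesis using K(2)[OF cutoff_L2[OF Y f]] True by simp
next
  case False
  define r where "r = complex_of_real (1 / L2_norm f)"
  have "L2_norm (\<lambda>x. r * f x) \<le> 1"
    unfolding r_def using L2_norm_scaled_unit[OF False] by simp
  from op_norm_cutoff_ball[OF Y L2_cmult[OF f] this]
  have "L2_norm (W (cutoff Y (\<lambda>x. r * f x))) \<le> op_norm (W \<circ> cutoff Y)" .
  also have "cutoff Y (\<lambda>x. r * f x) = (\<lambda>x. r * cutoff Y f x)"
    by (auto simp: cutoff_def mult_ac)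
  finally have "cmod r * L2_norm (W (cutoff Y f)) \<le> op_norm (W \<circ> cutoff Y)"
    unfolding norm_W_cmult[OF cutoff_L2[OF Y f]] .
  moreover have "cmod r = 1 / L2_norm f"
    unfolding r_def norm_of_real using L2_norm_nonneg[of f] by simp
  ultimately show ?thesis
    using False L2_norm_nonneg[of f] by (simp add: divide_simps mult.commute split: if_splits)
qed

section \<open>Lower bound\<close>

text \<open>
  The cut-off mode has squared norm \<open>\<mu>(Y)\<close> and is fixed by the cut-off.
\<close>

lemma column_localized_le:
  assumes Y: "Y \<in> sets torus" and L: "finite L"
  shows "(\<Sum>l\<in>L. (cmod (fourier_coeff (W (cutoff Y (fourier_mode j))) l))\<^sup>2)
    \<le> measure torus Y * (op_norm (W \<circ> cutoff Y))\<^sup>2"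
proof -
  let ?f = "cutoff Y (fourier_mode j)"
  have f: "?f \<in> L2_torus" by (rule cutoff_L2[OF Y L2_fourier_mode])
  have ff: "cutoff Y ?f = ?f" by (auto simp: cutoff_def split: split_indicator)
  have "(L2_norm ?f)\<^sup>2 = (LINT x|torus. indicator Y x)"
    unfolding L2_norm_sq
    by (rule Bochner_Integration.integral_cong) (auto simp: cutoff_def norm_mult split: split_indicator)
  also have "\<dots> = measure torus Y" using in_sets_torusD[OF Y] by (simp add: Int_absorb2)
  finally have n: "(L2_norm ?f)\<^sup>2 = measure torus Y" .
  have "(\<Sum>l\<in>L. (cmod (fourier_coeff (W ?f) l))\<^sup>2) \<le> (L2_norm (W ?f))\<^sup>2"
    by (rule Bessel[OF W_L2[OF f] L])
  also have "\<dots> \<le> (op_norm (W \<circ> cutoff Y) * L2_norm ?f)\<^sup>2"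
    using op_norm_cutoff_bound[OF Y f] unfolding ff by (rule power_mono) (rule L2_norm_nonneg)
  finally show ?thesis by (simp add: power_mult_distrib n mult.commute)
qed

text \<open>
  The matrix of \<open>\<pi>\<^sub>Y\<close> is the Toeplitz matrix of the coefficients of the indicator, which are square
  summable. The entries of the product with \<open>W\<close> are therefore dominated by the convolution of a summable
  and a square summable sequence, which is square summable.
\<close>

lemma localized_entries_off_diagonal:
  assumes Y: "Y \<in> sets torus"
  obtains q :: "int \<Rightarrow> real" where "q summable_on UNIV" "\<And>n. 0 \<le> q n"
    "\<And>l j. (cmod (fourier_coeff (W (cutoff Y (fourier_mode j))) l))\<^sup>2 \<le> q (l - j)"
proof
  let ?i = "cutoff Y (\<lambda>x. 1)"
  define a where "a = fourier_coeff ?i"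
  have i: "?i \<in> L2_torus"
    using cutoff_L2[OF Y L2_fourier_mode[of 0]] by (simp add: cutoff_def)
  have fin: "(\<Sum>n\<in>L. (cmod (a n))\<^sup>2) \<le> (L2_norm ?i)\<^sup>2" if "finite L" for L
    unfolding a_def by (rule Bessel[OF i that])
  have pt: "(cmod (a n))\<^sup>2 \<le> (L2_norm ?i)\<^sup>2" for n
    using fin[of "{n}"] by simp
  define q where "q n = C * (\<Sum>\<^sub>\<infinity>k. c k * (cmod (a (n - k)))\<^sup>2)" for n
  have summ: "(\<lambda>k. c k * (cmod (a (n - k)))\<^sup>2) summable_on UNIV" for n
    by (rule summable_on_mult_bounded[where B="(L2_norm ?i)\<^sup>2"])
      (rule c_summable c_nonneg zero_le_power2 pt)+
  show q0: "0 \<le> q n" for n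
    unfolding q_def by (intro mult_nonneg_nonneg C_nonneg infsum_nonneg) (auto simp: c_nonneg)
  show "q summable_on UNIV"
  proof (rule nonneg_bdd_above_summable_on[OF q0], rule bdd_aboveI2)
    fix L :: "int set" assume "L \<in> {F. F \<subseteq> UNIV \<and> finite F}"
    then have L: "finite L" by simp
    have "(\<Sum>n\<in>L. \<Sum>\<^sub>\<infinity>k. c k * (cmod (a (n - k)))\<^sup>2) \<le> (\<Sum>\<^sub>\<infinity>k. c k * (L2_norm ?i)\<^sup>2)"
    proof (rule finite_sum_weighted_infsum_le[OF c_summable c_nonneg])
      show "(\<Sum>n\<in>L. (cmod (a (n - k)))\<^sup>2) \<le> (L2_norm ?i)\<^sup>2" for k
        using fin[of "(\<lambda>n. n - k) ` L"] L by (simp add: sum.reindex inj_on_def)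
    qed (use L in auto)
    then show "sum q L \<le> C * (\<Sum>\<^sub>\<infinity>k. c k * (L2_norm ?i)\<^sup>2)"
      unfolding q_def sum_distrib_left[symmetric] by (intro mult_left_mono C_nonneg)
  qed
  fix l j
  have "fourier_coeff (cutoff Y (fourier_mode j)) k = a (k - j)" for k
    using fourier_coeff_mult_mode[of j ?i k] by (simp add: a_def cutoff_def mult.commute)
  then have s: "((\<lambda>k. w l k * a (k - j)) has_sum fourier_coeff (W (cutoff Y (fourier_mode j))) l) UNIV"
    using coeff_W_has_sum[OF cutoff_L2[OF Y L2_fourier_mode], of l j] by simp
  have t: "((\<lambda>k. c (l - k) * (cmod (a (k - j)))\<^sup>2) has_sum (\<Sum>\<^sub>\<infinity>k. c k * (cmod (a (l - j - k)))\<^sup>2)) UNIV"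
    using has_sum_reflect_int[OF has_sum_infsum[OF summ[of "l - j"]], of l] by (simp add: algebra_simps)
  show "(cmod (fourier_coeff (W (cutoff Y (fourier_mode j))) l))\<^sup>2 \<le> q (l - j)"
    unfolding q_def by (rule weighted_Cauchy_Schwarz_has_sum[OF s entry_le row_c_has_sum t])
qed

text \<open>
  Row sums and column sums of the squared entries of \<open>W \<pi>\<^sub>Y\<close> over a long interval almost agree:
  for a row at distance more than \<open>M\<close> from both ends the entries outside the interval contribute
  little, and the at most \<open>2 M\<close> remaining rows contribute at most the constant \<open>Q\<close> each.
\<close>

lemma row_average_localized_le:
  assumes Y: "Y \<in> sets torus" and "\<epsilon> > 0"
  shows "\<forall>\<^sub>F I in long_intervals.
    (1 / real (card I)) * (\<Sum>l\<in>I. LINT x|torus. indicator Y x * (cmod (row l x))\<^sup>2)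
      \<le> measure torus Y * (op_norm (W \<circ> cutoff Y))\<^sup>2 + \<epsilon>"
proof -
  obtain q :: "int \<Rightarrow> real" where q: "q summable_on UNIV" "\<And>n. 0 \<le> q n"
    and qb: "\<And>l j. (cmod (fourier_coeff (W (cutoff Y (fourier_mode j))) l))\<^sup>2 \<le> q (l - j)"
    using localized_entries_off_diagonal[OF Y] by blast
  define Q where "Q = (\<Sum>\<^sub>\<infinity>n. q n)"
  have Q: "sum q G \<le> Q" if "finite G" for G
    unfolding Q_def by (rule finite_sum_le_infsum[OF q(1) that]) (use q(2) in auto)
  have Q0: "0 \<le> Q" using Q[of "{}"] by simp
  have "\<epsilon> / 2 > 0" using \<open>\<epsilon> > 0\<close> by simp
  then obtain M :: nat where M: "\<And>G. finite G \<Longrightarrow> (\<And>n. n \<in> G \<Longrightarrow> \<bar>n\<bar> > int M) \<Longrightarrow> sum q G < \<epsilon> / 2"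
    using summable_on_int_tail_small[OF q] by blast
  \<comment> \<open>from this length on, the boundary rows cost at most \<open>\<epsilon> / 2\<close> on average\<close>
  define N where "N = nat \<lceil>4 * real M * Q / \<epsilon>\<rceil> + 1"
  define m where "m = measure torus Y * (op_norm (W \<circ> cutoff Y))\<^sup>2"
  let ?v = "\<lambda>l j. (cmod (fourier_coeff (W (cutoff Y (fourier_mode j))) l))\<^sup>2"
  show ?thesis
    unfolding eventually_long_intervals
  proof (intro exI allI impI)
    fix a b :: int assume card: "N \<le> card {a..b}"
    let ?I = "{a..b}"
    have outside: "(\<Sum>j\<in>J. ?v l j) \<le> (if l \<in> {a..<a + int M} \<union> {b - int M<..b} then Q else \<epsilon> / 2)"
      if J: "finite J" "J \<inter> ?I = {}" and l: "l \<in> ?I" for J l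
    proof -
      have "(\<Sum>j\<in>J. ?v l j) \<le> (\<Sum>j\<in>J. q (l - j))" by (rule sum_mono) (rule qb)
      also have "\<dots> = sum q ((\<lambda>j. l - j) ` J)" by (simp add: sum.reindex inj_on_def)
      also have "\<dots> \<le> (if l \<in> {a..<a + int M} \<union> {b - int M<..b} then Q else \<epsilon> / 2)"
      proof (cases "l \<in> {a..<a + int M} \<union> {b - int M<..b}")
        case True
        then show ?thesis using Q J by simp
      next
        case False
        have "sum q ((\<lambda>j. l - j) ` J) < \<epsilon> / 2"
        proof (rule M)
          fix n assume "n \<in> (\<lambda>j. l - j) ` J"
          then obtain j where j: "j \<in> J" "n = l - j" by auto
          then have "j < a \<or> b < j" using J(2) by auto
          then show "\<bar>n\<bar> > int M" using False l j(2) by auto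
        qed (use J in simp)
        then show ?thesis unfolding if_not_P[OF False] by simp
      qed
      finally show ?thesis .
    qed
    have "(\<Sum>l\<in>?I. LINT x|torus. indicator Y x * (cmod (row l x))\<^sup>2)
        \<le> real (card ?I) * m + (real (card ?I) * (\<epsilon> / 2) + 2 * real M * Q)"
    proof (rule has_sum_le_finite_sums[OF has_sum_finite_sum[OF row_localized_has_sum[OF Y]]])
      fix J :: "int set" assume J: "finite J" "J \<subseteq> UNIV"
      have "(\<Sum>j\<in>J. \<Sum>l\<in>?I. ?v l j) = (\<Sum>j\<in>J \<inter> ?I. \<Sum>l\<in>?I. ?v l j) + (\<Sum>j\<in>J - ?I. \<Sum>l\<in>?I. ?v l j)"
        by (rule sum.Int_Diff[OF J(1)])
      also have "(\<Sum>j\<in>J \<inter> ?I. \<Sum>l\<in>?I. ?v l j) \<le> (\<Sum>j\<in>J \<inter> ?I. m)"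
        unfolding m_def by (intro sum_mono column_localized_le[OF Y]) simp
      also have "(\<Sum>j\<in>J \<inter> ?I. m) \<le> real (card ?I) * m"
        unfolding sum_constant
        by (rule mult_right_mono) (auto simp: m_def simp del: card_atLeastAtMost_int intro!: card_mono)
      also have "(\<Sum>j\<in>J - ?I. \<Sum>l\<in>?I. ?v l j) = (\<Sum>l\<in>?I. \<Sum>j\<in>J - ?I. ?v l j)"
        by (rule sum.swap)
      also have "\<dots> \<le> (\<Sum>l\<in>?I. \<epsilon> / 2 + (if l \<in> {a..<a + int M} \<union> {b - int M<..b} then Q else 0))"
      proof (rule sum_mono)
        fix l assume l: "l \<in> ?I"
        have "(\<Sum>j\<in>J - ?I. ?v l j) \<le> (if l \<in> {a..<a + int M} \<union> {b - int M<..b} then Q else \<epsilon> / 2)"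
          by (rule outside) (use J l in auto)
        also have "\<dots> \<le> \<epsilon> / 2 + (if l \<in> {a..<a + int M} \<union> {b - int M<..b} then Q else 0)"
          using \<open>\<epsilon> > 0\<close> Q0 by simp
        finally show "(\<Sum>j\<in>J - ?I. ?v l j) \<le> \<epsilon> / 2 + (if l \<in> {a..<a + int M} \<union> {b - int M<..b} then Q else 0)" .
      qed
      also have "\<dots> = real (card ?I) * (\<epsilon> / 2) + real (card (?I \<inter> ({a..<a + int M} \<union> {b - int M<..b}))) * Q"
        by (simp only: sum.distrib sum_constant sum.If_cases[OF finite_atLeastAtMost_int] Collect_mem_eq sum.neutral_const add_0_right)
      also have "real (card (?I \<inter> ({a..<a + int M} \<union> {b - int M<..b}))) * Q \<le> (2 * real M) * Q"
      proof (rule mult_right_mono[OF _ Q0])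
        have "card (?I \<inter> ({a..<a + int M} \<union> {b - int M<..b})) \<le> card ({a..<a + int M} \<union> {b - int M<..b})"
          by (rule card_mono) auto
        also have "\<dots> \<le> card {a..<a + int M} + card {b - int M<..b}" by (rule card_Un_le)
        also have "\<dots> = 2 * M" by simp
        finally show "real (card (?I \<inter> ({a..<a + int M} \<union> {b - int M<..b}))) \<le> 2 * real M" by simp
      qed
      finally show "(\<Sum>j\<in>J. \<Sum>l\<in>?I. ?v l j) \<le> real (card ?I) * m + (real (card ?I) * (\<epsilon> / 2) + 2 * real M * Q)"
        by simp
    qed
    moreover have "2 * real M * Q \<le> real (card ?I) * (\<epsilon> / 2)"
    proof -
      have "4 * real M * Q / \<epsilon> \<le> real N" unfolding N_def by linarith
      also have "\<dots> \<le> real (card ?I)" using card by simp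
      finally show ?thesis using \<open>\<epsilon> > 0\<close> by (simp add: field_simps)
    qed
    ultimately have "(\<Sum>l\<in>?I. LINT x|torus. indicator Y x * (cmod (row l x))\<^sup>2) \<le> real (card ?I) * (m + \<epsilon>)"
      by (simp add: algebra_simps)
    moreover have "real (card ?I) > 0" using card unfolding N_def by linarith
    ultimately show "(1 / real (card ?I)) * (\<Sum>l\<in>?I. LINT x|torus. indicator Y x * (cmod (row l x))\<^sup>2)
        \<le> measure torus Y * (op_norm (W \<circ> cutoff Y))\<^sup>2 + \<epsilon>"
      unfolding m_def by (simp add: field_simps)
  qed
qed

text \<open>
  The blocks cover the circle up to a null set; overlaps only increase the right-hand side.
\<close>

lemma partition_row_norm_le:
  assumes "torus_partition K Y"
  shows "(L2_norm (row l))\<^sup>2 \<le> (\<Sum>i=1..K. LINT x|torus. indicator (Y i) x * (cmod (row l x))\<^sup>2)"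
proof -
  have Y: "Y i \<in> sets torus" if "i \<in> {1..K}" for i
    using assms that by (simp add: torus_partition_def)
  have int: "integrable torus (\<lambda>x. indicator (Y i) x * (cmod (row l x))\<^sup>2)" if "i \<in> {1..K}" for i
    using integrable_mult_indicator[OF Y[OF that] L2_square_integrable[OF row_L2]] by simp
  have "(L2_norm (row l))\<^sup>2 \<le> (LINT x|torus. (\<Sum>i=1..K. indicator (Y i) x * (cmod (row l x))\<^sup>2))"
    unfolding L2_norm_sq
  proof (rule integral_mono_AE[OF L2_square_integrable[OF row_L2]])
    show "integrable torus (\<lambda>x. \<Sum>i=1..K. indicator (Y i) x * (cmod (row l x))\<^sup>2)"
      by (rule Bochner_Integration.integrable_sum) (rule int)
    have "AE x in torus. x \<notin> space torus - (\<Union>i\<in>{1..K}. Y i)"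
      by (rule AE_not_in) (use assms in \<open>simp add: torus_partition_def\<close>)
    then show "AE x in torus. (cmod (row l x))\<^sup>2 \<le> (\<Sum>i=1..K. indicator (Y i) x * (cmod (row l x))\<^sup>2)"
      using AE_space
    proof eventually_elim
      case (elim x)
      then obtain i where i: "i \<in> {1..K}" "x \<in> Y i" by blast
      have "indicator (Y i) x * (cmod (row l x))\<^sup>2 \<le> (\<Sum>i=1..K. indicator (Y i) x * (cmod (row l x))\<^sup>2)"
        by (rule member_le_sum) (use i in auto)
      with i show ?case by simp
    qed
  qed
  also have "\<dots> = (\<Sum>i=1..K. LINT x|torus. indicator (Y i) x * (cmod (row l x))\<^sup>2)"
    by (rule Bochner_Integration.integral_sum) (rule int)
  finally show ?thesis .
qed

lemma partition_lower_bound: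
  assumes P: "torus_partition K Y" and "\<epsilon> > 0"
  shows "\<forall>\<^sub>F I in long_intervals. (1 / real (card I)) * (\<Sum>l\<in>I. (L2_norm (row l))\<^sup>2)
    \<le> (\<Sum>i=1..K. measure torus (Y i) * (op_norm (W \<circ> cutoff (Y i)))\<^sup>2) + \<epsilon>"
proof -
  define \<delta> where "\<delta> = \<epsilon> / (real K + 1)"
  have \<delta>: "\<delta> > 0" "real K * \<delta> \<le> \<epsilon>" using \<open>\<epsilon> > 0\<close> by (auto simp: \<delta>_def field_simps)
  have "\<forall>\<^sub>F I in long_intervals. \<forall>i\<in>{1..K}.
      (1 / real (card I)) * (\<Sum>l\<in>I. LINT x|torus. indicator (Y i) x * (cmod (row l x))\<^sup>2)
        \<le> measure torus (Y i) * (op_norm (W \<circ> cutoff (Y i)))\<^sup>2 + \<delta>"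
    using P by (intro eventually_ball_finite ballI row_average_localized_le \<delta>) (auto simp: torus_partition_def)
  then show ?thesis
  proof eventually_elim
    case (elim I)
    have "(1 / real (card I)) * (\<Sum>l\<in>I. (L2_norm (row l))\<^sup>2)
        \<le> (1 / real (card I)) * (\<Sum>l\<in>I. \<Sum>i=1..K. LINT x|torus. indicator (Y i) x * (cmod (row l x))\<^sup>2)"
      by (intro mult_left_mono sum_mono partition_row_norm_le[OF P]) auto
    also have "\<dots> = (\<Sum>i=1..K. (1 / real (card I)) * (\<Sum>l\<in>I. LINT x|torus. indicator (Y i) x * (cmod (row l x))\<^sup>2))"
      by (subst sum.swap) (simp add: sum_distrib_left)
    also have "\<dots> \<le> (\<Sum>i=1..K. measure torus (Y i) * (op_norm (W \<circ> cutoff (Y i)))\<^sup>2 + \<delta>)"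
      by (rule sum_mono) (use elim in blast)
    also have "\<dots> = (\<Sum>i=1..K. measure torus (Y i) * (op_norm (W \<circ> cutoff (Y i)))\<^sup>2) + real K * \<delta>"
      by (simp add: sum.distrib)
    finally show ?case using \<delta>(2) by linarith
  qed
qed

end

section \<open>Upper bound on short arcs\<close>

lemma norm_cis_diff_le: "cmod (cis a - cis b) \<le> \<bar>a - b\<bar>"
proof -
  have "(cmod (cis a - cis b))\<^sup>2 = 2 - 2 * cos (a - b)"
    unfolding cmod_power2
    using sin_cos_squared_add[of a] sin_cos_squared_add[of b]
    by (simp add: power2_eq_square algebra_simps cos_diff)
  also have "\<dots> = 4 * (sin ((a - b) / 2))\<^sup>2"
  proof -
    have "cos (2 * ((a - b) / 2)) = 1 - 2 * (sin ((a - b) / 2))\<^sup>2" by (rule cos_double_sin)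
    also have "2 * ((a - b) / 2) = a - b" by simp
    finally show ?thesis by simp
  qed
  also have "\<dots> \<le> 4 * ((a - b) / 2)\<^sup>2"
    by (intro mult_left_mono abs_le_square_iff[THEN iffD1] abs_sin_x_le_abs_x) simp
  also have "\<dots> = \<bar>a - b\<bar>\<^sup>2" by (simp add: power2_eq_square)
  finally show ?thesis by (rule power2_le_imp_le) simp
qed

text \<open>
  Up to a factor of modulus one the difference is that of one mode at \<open>x\<close> and at \<open>y\<close>. The constant
  bound is needed for large frequencies, where the Lipschitz bound is useless.
\<close>

lemma fourier_mode_shift_diff_sq_le:
  assumes "\<bar>x - y\<bar> \<le> \<delta>" "\<bar>real_of_int r\<bar> \<le> R"
  shows "(cmod (fourier_mode k x - fourier_mode (k + r) y * fourier_mode (- r) x))\<^sup>2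
    \<le> min 4 (((\<bar>real_of_int k\<bar> + R) * \<delta>)\<^sup>2)"
proof -
  let ?z = "fourier_mode k x - fourier_mode (k + r) y * fourier_mode (- r) x"
  have "cmod ?z \<le> cmod (fourier_mode k x) + cmod (fourier_mode (k + r) y * fourier_mode (- r) x)"
    by (rule norm_triangle_ineq4)
  then have "cmod ?z \<le> 2" by (simp add: norm_mult)
  then have "(cmod ?z)\<^sup>2 \<le> 2\<^sup>2" by (rule power_mono) simp
  then have 1: "(cmod ?z)\<^sup>2 \<le> 4" by simp
  have "?z = fourier_mode (- r) x * (fourier_mode (k + r) x - fourier_mode (k + r) y)"
    using fourier_mode_add[of "- r" "k + r" x] by (simp add: algebra_simps)
  then have "cmod ?z = cmod (fourier_mode (k + r) x - fourier_mode (k + r) y)"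
    by (simp add: norm_mult)
  also have "\<dots> \<le> \<bar>of_int (k + r) * x - of_int (k + r) * y\<bar>"
    unfolding fourier_mode_cis by (rule norm_cis_diff_le)
  also have "\<dots> = \<bar>real_of_int (k + r)\<bar> * \<bar>x - y\<bar>"
    by (simp only: right_diff_distrib[symmetric] abs_mult)
  also have "\<dots> \<le> (\<bar>real_of_int k\<bar> + R) * \<delta>"
  proof (rule mult_mono)
    have "\<bar>real_of_int (k + r)\<bar> \<le> \<bar>real_of_int k\<bar> + \<bar>real_of_int r\<bar>" by simp
    with assms(2) show "\<bar>real_of_int (k + r)\<bar> \<le> \<bar>real_of_int k\<bar> + R" by linarith
  qed (use assms in auto)
  finally have "(cmod ?z)\<^sup>2 \<le> ((\<bar>real_of_int k\<bar> + R) * \<delta>)\<^sup>2" by (rule power_mono) simp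
  with 1 show ?thesis by simp
qed

text \<open>
  Unlike the symmetric inequality with constants \<open>2\<close>, this one spoils the main term \<open>b\<close> only by a
  factor close to one, at the price of a large factor on the error \<open>e\<close>.
\<close>

lemma cmod_add_sq_weighted_le:
  assumes "\<theta> > 0"
  shows "(cmod (b + e))\<^sup>2 \<le> (1 + \<theta>) * (cmod b)\<^sup>2 + (1 + 1 / \<theta>) * (cmod e)\<^sup>2"
proof -
  have "(cmod (b + e))\<^sup>2 \<le> (cmod b + cmod e)\<^sup>2"
    by (intro power_mono norm_triangle_ineq) simp
  moreover have "0 \<le> (\<theta> * cmod b - cmod e)\<^sup>2 / \<theta>" using assms by simp
  then have "2 * cmod b * cmod e \<le> \<theta> * (cmod b)\<^sup>2 + (cmod e)\<^sup>2 / \<theta>"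
    using assms by (simp add: power2_eq_square field_simps)
  ultimately show ?thesis by (simp add: power2_sum algebra_simps)
qed

context diagonal_type_operator
begin

text \<open>
  Bounds the squared \<open>\<ell>\<^sup>2\<close> error made by evaluating modes at one point \<open>y\<close> instead of at the
  points within distance \<open>\<delta>\<close> of it, when in addition indices are shifted by up to \<open>R\<close>.
\<close>

definition freezing_error :: "real \<Rightarrow> real \<Rightarrow> real" where
  "freezing_error R \<delta> = C * (\<Sum>\<^sub>\<infinity>k. c k * min 4 (((\<bar>real_of_int k\<bar> + R) * \<delta>)\<^sup>2))"

text \<open>
  The \<open>j\<close>-th coefficient of \<open>f\<close> is replaced by a phase, taken at \<open>y\<close>, times the coefficient of index
  \<open>l + r\<close>. Along the diagonal \<open>j = l - k\<close> the replacement error is the \<open>l\<close>-th coefficient of \<open>f\<close>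
  multiplied by a function that is small on the support of \<open>f\<close>, so Bessel's inequality bounds the sum over \<open>l\<close>.
\<close>

lemma frozen_row_error:
  assumes f: "f \<in> L2_torus" "L2_norm f \<le> 1"
    and supp: "\<And>x. x \<in> {0..<2*pi} \<Longrightarrow> f x \<noteq> 0 \<Longrightarrow> \<bar>x - y\<bar> \<le> \<delta>"
    and r: "\<bar>real_of_int r\<bar> \<le> R" and L: "finite L"
  shows "(\<Sum>l\<in>L. (cmod (fourier_coeff (W f) l
      - row l y * (fourier_mode (l + r) y * fourier_coeff f (l + r))))\<^sup>2) \<le> freezing_error R \<delta>"
proof -
  let ?a = "fourier_coeff f"
  \<comment> \<open>the replacement error along the \<open>k\<close>-th diagonal, as a function on the circle\<close>
  define g where "g k = (\<lambda>x. (fourier_mode k x - fourier_mode (k + r) y * fourier_mode (- r) x) * f x)" for k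
  define B where "B k = min 4 (((\<bar>real_of_int k\<bar> + R) * \<delta>)\<^sup>2)" for k :: int
  have B0: "0 \<le> B k" "B k \<le> 4" for k by (auto simp: B_def)
  have g_split: "g k = (\<lambda>x. fourier_mode k x * f x - fourier_mode (k + r) y * (fourier_mode (- r) x * f x))" for k
    by (simp add: g_def algebra_simps)
  have gL2: "g k \<in> L2_torus" for k
    unfolding g_split by (intro L2_diff L2_cmult L2_mult_mode f)
  have g_coeff: "fourier_coeff (g k) l = ?a (l - k) - fourier_mode (k + r) y * ?a (l + r)" for k l
    unfolding g_split
    by (simp add: fourier_coeff_diff L2_cmult L2_mult_mode f fourier_coeff_cmult fourier_coeff_mult_mode)
  have g_sum: "(\<Sum>l\<in>L'. (cmod (fourier_coeff (g k) l))\<^sup>2) \<le> B k" if "finite L'" for k L'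
  proof -
    have "(\<Sum>l\<in>L'. (cmod (fourier_coeff (g k) l))\<^sup>2) \<le> (L2_norm (g k))\<^sup>2"
      by (rule Bessel[OF gL2 that])
    also have "\<dots> \<le> B k * (L2_norm f)\<^sup>2"
    proof (rule L2_norm_sq_mono[OF L2_measurable[OF gL2] f(1) B0(1)])
      fix x assume x: "x \<in> {0..<2*pi}"
      show "(cmod (g k x))\<^sup>2 \<le> B k * (cmod (f x))\<^sup>2"
      proof (cases "f x = 0")
        case False
        then show ?thesis
          unfolding g_def norm_mult power_mult_distrib[of _ "cmod (f x)"] B_def
          by (intro mult_right_mono fourier_mode_shift_diff_sq_le supp x r zero_le_power2)
      qed (simp add: g_def)
    qed
    also have "\<dots> \<le> B k * 1"
      using f(2) power_mono[OF f(2) L2_norm_nonneg, of 2] by (intro mult_left_mono B0) simp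
    finally show ?thesis by simp
  qed
  have pt: "(cmod (fourier_coeff (g k) l))\<^sup>2 \<le> 4" for k l
    using g_sum[of "{l}" k] B0(2)[of k] by simp
  have E: "(cmod (fourier_coeff (W f) l - row l y * (fourier_mode (l + r) y * ?a (l + r))))\<^sup>2
      \<le> C * (\<Sum>\<^sub>\<infinity>k. c k * (cmod (fourier_coeff (g k) l))\<^sup>2)" for l
  proof -
    let ?E = "fourier_coeff (W f) l - row l y * (fourier_mode (l + r) y * ?a (l + r))"
    have "((\<lambda>j. w l j * ?a j - w l j * fourier_mode (- j) y * (fourier_mode (l + r) y * ?a (l + r))) has_sum ?E) UNIV"
      by (intro has_sum_diff coeff_W_has_sum f has_sum_cmult_left row_has_sum)
    moreover have "w l j * ?a j - w l j * fourier_mode (- j) y * (fourier_mode (l + r) y * ?a (l + r))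
        = w l j * fourier_coeff (g (l - j)) l" for j
    proof -
      have "fourier_mode (- j) y * fourier_mode (l + r) y = fourier_mode (l - j + r) y"
        unfolding fourier_mode_add[symmetric] by (simp add: algebra_simps)
      then show ?thesis
        unfolding g_coeff by (simp add: right_diff_distrib mult.assoc[symmetric])
    qed
    ultimately have s: "((\<lambda>j. w l j * fourier_coeff (g (l - j)) l) has_sum ?E) UNIV" by simp
    have t: "((\<lambda>j. c (l - j) * (cmod (fourier_coeff (g (l - j)) l))\<^sup>2) has_sum
        (\<Sum>\<^sub>\<infinity>k. c k * (cmod (fourier_coeff (g k) l))\<^sup>2)) UNIV"
      by (rule has_sum_reflect_int[where f="\<lambda>k. c k * (cmod (fourier_coeff (g k) l))\<^sup>2"],
          rule has_sum_infsum, rule summable_on_mult_bounded[where B=4],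
          (rule c_summable c_nonneg zero_le_power2 pt)+)
    show ?thesis
      by (rule weighted_Cauchy_Schwarz_has_sum[OF s entry_le row_c_has_sum t])
  qed
  have "(\<Sum>l\<in>L. (cmod (fourier_coeff (W f) l - row l y * (fourier_mode (l + r) y * ?a (l + r))))\<^sup>2)
      \<le> C * (\<Sum>l\<in>L. \<Sum>\<^sub>\<infinity>k. c k * (cmod (fourier_coeff (g k) l))\<^sup>2)"
    unfolding sum_distrib_left by (rule sum_mono) (rule E)
  also have "\<dots> \<le> C * (\<Sum>\<^sub>\<infinity>k. c k * B k)"
    by (rule mult_left_mono[OF _ C_nonneg], rule finite_sum_weighted_infsum_le[where b=4])
      (rule c_summable c_nonneg zero_le_power2 g_sum L B0)+
  finally show ?thesis by (simp add: freezing_error_def B_def)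
qed

text \<open>
  The freedom in the shift \<open>r\<close> is what allows averaging: adding the estimates for all \<open>r < N\<close> and
  collecting the terms with the same coefficient \<open>m = l + r\<close> of \<open>f\<close> puts the window
  average of the squared rows at \<open>y\<close> in front of it.
\<close>

lemma local_upper_bound:
  assumes f: "f \<in> L2_torus" "L2_norm f \<le> 1"
    and supp: "\<And>x. x \<in> {0..<2*pi} \<Longrightarrow> f x \<noteq> 0 \<Longrightarrow> \<bar>x - y\<bar> \<le> \<delta>"
    and N: "N > 0" and avg: "\<And>m. (\<Sum>r<N. (cmod (row (m - int r) y))\<^sup>2) \<le> real N * B" and "\<theta> > 0"
  shows "(L2_norm (W f))\<^sup>2 \<le> (1 + \<theta>) * B + (1 + 1 / \<theta>) * freezing_error (real N) \<delta>"
proof (rule has_sum_le_finite_sums[OF Parseval[OF W_L2[OF f(1)]]])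
  fix L :: "int set" assume L: "finite L" "L \<subseteq> UNIV"
  let ?a = "fourier_coeff f" and ?A = "fourier_coeff (W f)"
  have B: "0 \<le> B"
  proof -
    have "0 \<le> real N * B" by (rule order_trans[OF sum_nonneg avg]) simp
    then show ?thesis using N by (simp add: zero_le_mult_iff)
  qed
  define L' where "L' = (\<Union>r<N. (\<lambda>l. l + int r) ` L)"
  have L': "finite L'" using L by (simp add: L'_def)
  have main: "(\<Sum>r<N. \<Sum>l\<in>L. (cmod (row l y))\<^sup>2 * (cmod (?a (l + int r)))\<^sup>2) \<le> real N * B"
  proof -
    have "(\<Sum>r<N. \<Sum>l\<in>L. (cmod (row l y))\<^sup>2 * (cmod (?a (l + int r)))\<^sup>2)
        \<le> (\<Sum>r<N. \<Sum>m\<in>L'. (cmod (row (m - int r) y))\<^sup>2 * (cmod (?a m))\<^sup>2)"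
    proof (rule sum_mono)
      fix r assume r: "r \<in> {..<N}"
      have "(\<Sum>l\<in>L. (cmod (row l y))\<^sup>2 * (cmod (?a (l + int r)))\<^sup>2)
          = (\<Sum>m\<in>(\<lambda>l. l + int r) ` L. (cmod (row (m - int r) y))\<^sup>2 * (cmod (?a m))\<^sup>2)"
        by (simp add: sum.reindex inj_on_def)
      also have "\<dots> \<le> (\<Sum>m\<in>L'. (cmod (row (m - int r) y))\<^sup>2 * (cmod (?a m))\<^sup>2)"
        by (rule sum_mono2[OF L']) (use r in \<open>auto simp: L'_def\<close>)
      finally show "(\<Sum>l\<in>L. (cmod (row l y))\<^sup>2 * (cmod (?a (l + int r)))\<^sup>2)
          \<le> (\<Sum>m\<in>L'. (cmod (row (m - int r) y))\<^sup>2 * (cmod (?a m))\<^sup>2)" .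
    qed
    also have "\<dots> = (\<Sum>m\<in>L'. (\<Sum>r<N. (cmod (row (m - int r) y))\<^sup>2) * (cmod (?a m))\<^sup>2)"
      by (subst sum.swap) (simp add: sum_distrib_right)
    also have "\<dots> \<le> (\<Sum>m\<in>L'. (real N * B) * (cmod (?a m))\<^sup>2)"
      by (intro sum_mono mult_right_mono avg) simp
    also have "\<dots> = (real N * B) * (\<Sum>m\<in>L'. (cmod (?a m))\<^sup>2)" by (simp add: sum_distrib_left)
    also have "\<dots> \<le> (real N * B) * 1"
    proof (rule mult_left_mono)
      show "(\<Sum>m\<in>L'. (cmod (?a m))\<^sup>2) \<le> 1"
        using Bessel[OF f(1) L'] power_mono[OF f(2) L2_norm_nonneg, of 2] by simp
    qed (use B in simp)
    finally show ?thesis by simp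
  qed
  have "real N * (\<Sum>l\<in>L. (cmod (?A l))\<^sup>2) = (\<Sum>r<N. \<Sum>l\<in>L. (cmod (?A l))\<^sup>2)" by simp
  also have "\<dots> \<le> (\<Sum>r<N. (1 + \<theta>) * (\<Sum>l\<in>L. (cmod (row l y))\<^sup>2 * (cmod (?a (l + int r)))\<^sup>2)
      + (1 + 1 / \<theta>) * freezing_error (real N) \<delta>)"
  proof (rule sum_mono)
    fix r assume r: "r \<in> {..<N}"
    let ?b = "\<lambda>l. row l y * (fourier_mode (l + int r) y * ?a (l + int r))"
    have "(\<Sum>l\<in>L. (cmod (?A l))\<^sup>2) \<le> (\<Sum>l\<in>L. (1 + \<theta>) * (cmod (?b l))\<^sup>2 + (1 + 1 / \<theta>) * (cmod (?A l - ?b l))\<^sup>2)"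
    proof (rule sum_mono)
      fix l
      show "(cmod (?A l))\<^sup>2 \<le> (1 + \<theta>) * (cmod (?b l))\<^sup>2 + (1 + 1 / \<theta>) * (cmod (?A l - ?b l))\<^sup>2"
        using cmod_add_sq_weighted_le[OF \<open>\<theta> > 0\<close>, of "?b l" "?A l - ?b l"] by simp
    qed
    also have "\<dots> = (1 + \<theta>) * (\<Sum>l\<in>L. (cmod (?b l))\<^sup>2) + (1 + 1 / \<theta>) * (\<Sum>l\<in>L. (cmod (?A l - ?b l))\<^sup>2)"
      by (simp only: sum.distrib sum_distrib_left)
    also have "\<dots> \<le> (1 + \<theta>) * (\<Sum>l\<in>L. (cmod (?b l))\<^sup>2) + (1 + 1 / \<theta>) * freezing_error (real N) \<delta>"
      by (intro add_left_mono mult_left_mono frozen_row_error[OF f supp _ L(1)]) (use r \<open>\<theta> > 0\<close> in auto)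
    also have "(\<Sum>l\<in>L. (cmod (?b l))\<^sup>2) = (\<Sum>l\<in>L. (cmod (row l y))\<^sup>2 * (cmod (?a (l + int r)))\<^sup>2)"
      by (simp add: norm_mult power_mult_distrib)
    finally show "(\<Sum>l\<in>L. (cmod (?A l))\<^sup>2) \<le> (1 + \<theta>) * (\<Sum>l\<in>L. (cmod (row l y))\<^sup>2 * (cmod (?a (l + int r)))\<^sup>2)
      + (1 + 1 / \<theta>) * freezing_error (real N) \<delta>" .
  qed
  also have "\<dots> = (1 + \<theta>) * (\<Sum>r<N. \<Sum>l\<in>L. (cmod (row l y))\<^sup>2 * (cmod (?a (l + int r)))\<^sup>2)
      + real N * ((1 + 1 / \<theta>) * freezing_error (real N) \<delta>)"
    by (simp add: sum.distrib sum_distrib_left)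
  also have "\<dots> \<le> (1 + \<theta>) * (real N * B) + real N * ((1 + 1 / \<theta>) * freezing_error (real N) \<delta>)"
    using main \<open>\<theta> > 0\<close> by (intro add_right_mono mult_left_mono) auto
  also have "\<dots> = real N * ((1 + \<theta>) * B + (1 + 1 / \<theta>) * freezing_error (real N) \<delta>)"
    by (simp add: algebra_simps)
  finally show "(\<Sum>l\<in>L. (cmod (?A l))\<^sup>2) \<le> (1 + \<theta>) * B + (1 + 1 / \<theta>) * freezing_error (real N) \<delta>"
    using N by simp
qed

text \<open>
  Dominated convergence: frequencies beyond \<open>M\<close> are controlled by the tail of \<open>c\<close> and the constant
  bound, the others by the Lipschitz bound.
\<close>

lemma freezing_error_tendsto_0:
  assumes "0 \<le> R"
  shows "(\<lambda>n. freezing_error R (2 * pi / real n)) \<longlonglongrightarrow> 0"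
proof -
  let ?B = "\<lambda>n k. min 4 (((\<bar>real_of_int k\<bar> + R) * (2 * pi / real n))\<^sup>2)"
  have summ: "(\<lambda>k. c k * ?B n k) summable_on UNIV" for n
    by (rule summable_on_mult_bounded[where B=4]) (auto intro: c_summable c_nonneg)
  have "(\<lambda>n. \<Sum>\<^sub>\<infinity>k. c k * ?B n k) \<longlonglongrightarrow> 0"
  proof (rule LIMSEQ_I)
    fix e :: real assume "e > 0"
    then have "e / 8 > 0" by simp
    then obtain M :: nat where M: "\<And>G. finite G \<Longrightarrow> (\<And>n. n \<in> G \<Longrightarrow> \<bar>n\<bar> > int M) \<Longrightarrow> sum c G < e / 8"
      using summable_on_int_tail_small[OF c_summable c_nonneg] by blast
    have "(\<lambda>n. C * ((real M + R) * (2 * pi / real n))\<^sup>2) \<longlonglongrightarrow> C * ((real M + R) * 0)\<^sup>2"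
      by (intro tendsto_intros lim_const_over_n)
    then have "\<forall>\<^sub>F n in sequentially. C * ((real M + R) * (2 * pi / real n))\<^sup>2 < e / 4"
      by (rule order_tendstoD(2)) (use \<open>e > 0\<close> in simp)
    then obtain n0 where n0: "\<And>n. n \<ge> n0 \<Longrightarrow> C * ((real M + R) * (2 * pi / real n))\<^sup>2 < e / 4"
      by (auto simp: eventually_sequentially)
    show "\<exists>no. \<forall>n\<ge>no. norm ((\<Sum>\<^sub>\<infinity>k. c k * ?B n k) - 0) < e"
    proof (intro exI allI impI)
      fix n assume n: "n \<ge> n0"
      have "(\<Sum>\<^sub>\<infinity>k. c k * ?B n k) \<le> 3 * e / 4"
      proof (rule has_sum_le_finite_sums[OF has_sum_infsum[OF summ]])
        fix F :: "int set" assume F: "finite F" "F \<subseteq> UNIV"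
        have "(\<Sum>k\<in>F. c k * ?B n k) = (\<Sum>k\<in>F \<inter> {- int M..int M}. c k * ?B n k) + (\<Sum>k\<in>F - {- int M..int M}. c k * ?B n k)"
          by (rule sum.Int_Diff[OF F(1)])
        also have "(\<Sum>k\<in>F \<inter> {- int M..int M}. c k * ?B n k) \<le> (\<Sum>k\<in>F \<inter> {- int M..int M}. c k * ((real M + R) * (2 * pi / real n))\<^sup>2)"
        proof (intro sum_mono mult_left_mono c_nonneg)
          fix k assume "k \<in> F \<inter> {- int M..int M}"
          then have "\<bar>real_of_int k\<bar> \<le> real M" by auto
          then have "((\<bar>real_of_int k\<bar> + R) * (2 * pi / real n))\<^sup>2 \<le> ((real M + R) * (2 * pi / real n))\<^sup>2"
            using assms by (intro power_mono mult_right_mono) auto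
          then show "?B n k \<le> ((real M + R) * (2 * pi / real n))\<^sup>2" by simp
        qed
        also have "\<dots> \<le> C * ((real M + R) * (2 * pi / real n))\<^sup>2"
          unfolding sum_distrib_right[symmetric]
          by (intro mult_right_mono finite_sum_le_has_sum[OF c_has_sum]) (use F c_nonneg in auto)
        also have "(\<Sum>k\<in>F - {- int M..int M}. c k * ?B n k) \<le> (\<Sum>k\<in>F - {- int M..int M}. c k * 4)"
          by (intro sum_mono mult_left_mono c_nonneg) simp
        also have "\<dots> = 4 * sum c (F - {- int M..int M})" by (simp add: sum_distrib_left mult.commute)
        also have "sum c (F - {- int M..int M}) < e / 8"
          by (rule M) (use F in auto)
        finally show "(\<Sum>k\<in>F. c k * ?B n k) \<le> 3 * e / 4" using n0[OF n] by simp
      qed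
      moreover have "0 \<le> (\<Sum>\<^sub>\<infinity>k. c k * ?B n k)"
        by (rule infsum_nonneg) (simp add: c_nonneg)
      ultimately show "norm ((\<Sum>\<^sub>\<infinity>k. c k * ?B n k) - 0) < e" using \<open>e > 0\<close> by simp
    qed
  qed
  from tendsto_mult_right_zero[OF this, of C] show ?thesis
    unfolding freezing_error_def .
qed

end

section \<open>Averaged correlations\<close>

lemma summable_on_product_nonneg:
  fixes u :: "'a \<Rightarrow> real" and v :: "'b \<Rightarrow> real"
  assumes u: "u summable_on UNIV" "\<And>x. 0 \<le> u x" and v: "v summable_on UNIV" "\<And>x. 0 \<le> v x"
  shows "(\<lambda>(x, y). u x * v y) summable_on UNIV \<times> UNIV"
proof (rule nonneg_bdd_above_summable_on)
  show "bdd_above (sum (\<lambda>(x, y). u x * v y) ` {F. F \<subseteq> UNIV \<times> UNIV \<and> finite F})"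
  proof (rule bdd_aboveI2)
    fix F :: "('a \<times> 'b) set" assume "F \<in> {F. F \<subseteq> UNIV \<times> UNIV \<and> finite F}"
    then have F: "finite F" by simp
    have "sum (\<lambda>(x, y). u x * v y) F \<le> sum (\<lambda>(x, y). u x * v y) (fst ` F \<times> snd ` F)"
      by (rule sum_mono2) (use F u v in \<open>auto intro: rev_image_eqI\<close>)
    also have "\<dots> = sum u (fst ` F) * sum v (snd ` F)"
      by (simp add: sum_product sum.cartesian_product)
    also have "\<dots> \<le> infsum u UNIV * infsum v UNIV"
      by (intro mult_mono finite_sum_le_infsum u v infsum_nonneg sum_nonneg) (use F in auto)
    finally show "sum (\<lambda>(x, y). u x * v y) F \<le> infsum u UNIV * infsum v UNIV" .
  qed
qed (use u v in auto)

lemma has_sum_times_finite: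
  fixes f :: "'i \<Rightarrow> 'a \<Rightarrow> 'b::topological_comm_monoid_add"
  assumes "finite I" "\<And>l. l \<in> I \<Longrightarrow> (f l has_sum s l) UNIV"
  shows "((\<lambda>(j, l). f l j) has_sum (\<Sum>l\<in>I. s l)) (UNIV \<times> I)"
proof -
  have "((\<lambda>(j, l). f l j) has_sum s l) (UNIV \<times> {l})" if "l \<in> I" for l
  proof -
    have "bij_betw (\<lambda>j. (j, l)) UNIV (UNIV \<times> {l})" by (rule bij_betwI[where g=fst]) auto
    from has_sum_reindex_bij_betw[OF this, of "\<lambda>(j, l). f l j"] assms(2)[OF that]
    show ?thesis by simp
  qed
  then have "((\<lambda>(j, l). f l j) has_sum (\<Sum>l\<in>I. s l)) (\<Union>l\<in>I. UNIV \<times> {l})"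
    by (intro sum_has_sum assms(1)) auto
  also have "(\<Union>l\<in>I. UNIV \<times> {l}) = UNIV \<times> I" by auto
  finally show ?thesis .
qed

lemma long_intervals_neq_bot: "long_intervals \<noteq> bot"
proof -
  have "\<not> eventually (\<lambda>_. False) long_intervals"
    unfolding eventually_long_intervals
  proof (intro notI, elim exE)
    fix N assume "\<forall>a b :: int. N \<le> card {a..b} \<longrightarrow> False"
    from this[rule_format, of 1 "int N"] show False by simp
  qed
  then show ?thesis by (simp add: trivial_limit_def)
qed

lemma bij_shear: "bij_betw (\<lambda>(n, j). (j, j + n)) (UNIV \<times> UNIV) (UNIV \<times> (UNIV :: int set))"
  by (rule bij_betwI[where g="\<lambda>(j, j'). (j' - j, j)"]) auto

context diagonal_type_operator
begin

text \<open>The contribution of row \<open>l\<close> to the correlation mean.\<close>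

definition row_corr :: "int \<Rightarrow> int \<Rightarrow> complex" where
  "row_corr l n = (\<Sum>\<^sub>\<infinity>j. w l j * cnj (w l (j + n)))"

text \<open>A summable majorant, uniform in the row, of the correlations.\<close>

definition c_conv :: "int \<Rightarrow> real" where
  "c_conv n = (\<Sum>\<^sub>\<infinity>k. c k * c (k - n))"

lemma c_pairs_summable: "(\<lambda>(n, k). c k * c (k - n)) summable_on UNIV \<times> UNIV"
proof -
  have "bij_betw (\<lambda>(n, k). (k, k - n)) (UNIV \<times> UNIV) (UNIV \<times> (UNIV :: int set))"
    by (rule bij_betwI[where g="\<lambda>(k, k'). (k - k', k)"]) auto
  from summable_on_reindex_bij_betw[OF this, of "\<lambda>(k, k'). c k * c k'"]
    summable_on_product_nonneg[OF c_summable c_nonneg c_summable c_nonneg]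
  show ?thesis by (simp add: case_prod_unfold)
qed

lemma c_conv_has_sum: "((\<lambda>k. c k * c (k - n)) has_sum c_conv n) UNIV"
  unfolding c_conv_def by (rule has_sum_infsum) (rule summable_on_SigmaD1[OF c_pairs_summable], simp)

lemma c_conv_nonneg: "0 \<le> c_conv n"
  by (rule has_sum_nonneg[OF c_conv_has_sum]) (simp add: c_nonneg)

lemma c_conv_summable: "c_conv summable_on UNIV"
  by (rule has_sum_imp_summable, rule has_sum_SigmaD[OF has_sum_infsum[OF c_pairs_summable]])
    (simp add: c_conv_has_sum)

lemma row_corr_majorant_has_sum: "((\<lambda>j. c (l - j) * c (l - j - n)) has_sum c_conv n) UNIV"
  by (rule has_sum_reflect_int[where f="\<lambda>k. c k * c (k - n)"]) (rule c_conv_has_sum)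

lemma norm_corr_term_le: "norm (w l j * cnj (w l (j + n))) \<le> c (l - j) * c (l - j - n)"
  unfolding norm_mult complex_mod_cnj
  using entry_le[of l "j + n"] by (intro mult_mono entry_le) (auto simp: c_nonneg algebra_simps)

lemma row_corr_has_sum: "((\<lambda>j. w l j * cnj (w l (j + n))) has_sum row_corr l n) UNIV"
  unfolding row_corr_def
  by (rule has_sum_infsum, rule abs_summable_summable,
      rule summable_on_comparison_test[OF has_sum_imp_summable[OF row_corr_majorant_has_sum[of l n]]])
    (rule norm_corr_term_le norm_ge_zero)+

lemma norm_row_corr_le: "cmod (row_corr l n) \<le> c_conv n"
  by (rule norm_infsum_le[OF row_corr_has_sum row_corr_majorant_has_sum]) (rule norm_corr_term_le)

lemma row_corr_0: "row_corr l 0 = of_real ((L2_norm (row l))\<^sup>2)"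
proof -
  have "((\<lambda>j. w l j * cnj (w l (j + 0))) has_sum of_real ((L2_norm (row l))\<^sup>2)) UNIV"
    using has_sum_of_real[OF row_norm_has_sum[of l], where ?'a=complex]
    unfolding complex_norm_square add_0_right .
  with row_corr_has_sum[of l 0] show ?thesis by (rule has_sum_unique)
qed

text \<open>
  The Fourier series of \<open>|H\<^sub>l|\<^sup>2\<close>: multiply the series of \<open>H\<^sub>l\<close> by its conjugate and collect the
  terms according to the difference \<open>n\<close> of the frequencies.
\<close>

lemma row_norm_sq_has_sum_corr:
  "((\<lambda>n. fourier_mode n y * row_corr l n) has_sum of_real ((cmod (row l y))\<^sup>2)) UNIV"
proof -
  let ?u = "\<lambda>j. w l j * fourier_mode (- j) y"
  have "(\<lambda>(j, j'). ?u j * cnj (?u j')) summable_on UNIV \<times> UNIV"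
  proof (rule abs_summable_summable, rule summable_on_comparison_test)
    show "(\<lambda>(j, j'). c (l - j) * c (l - j')) summable_on UNIV \<times> UNIV"
      by (intro summable_on_product_nonneg has_sum_imp_summable[OF row_c_has_sum] c_nonneg)
  qed (auto simp: norm_mult intro!: mult_mono entry_le c_nonneg)
  moreover have "((\<lambda>j'. ?u j * cnj (?u j')) has_sum ?u j * cnj (row l y)) UNIV" for j
    using row_has_sum[of l y] by (intro has_sum_cmult_right) (simp only: has_sum_cnj_iff)
  moreover have "((\<lambda>j. ?u j * cnj (row l y)) has_sum row l y * cnj (row l y)) UNIV"
    by (intro has_sum_cmult_left row_has_sum)
  ultimately have "((\<lambda>(j, j'). ?u j * cnj (?u j')) has_sum row l y * cnj (row l y)) (UNIV \<times> UNIV)"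
    by (intro has_sum_SigmaI[where g="\<lambda>j. ?u j * cnj (row l y)"]) auto
  then have "((\<lambda>(n, j). ?u j * cnj (?u (j + n))) has_sum row l y * cnj (row l y)) (UNIV \<times> UNIV)"
    using has_sum_reindex_bij_betw[OF bij_shear, of "\<lambda>(j, j'). ?u j * cnj (?u j')"]
    by (simp add: case_prod_unfold)
  moreover have eq: "?u j * cnj (?u (j + n)) = fourier_mode n y * (w l j * cnj (w l (j + n)))" for j n
  proof -
    have "fourier_mode (- j) y * fourier_mode (n + j) y = fourier_mode n y"
      unfolding fourier_mode_add[symmetric] by simp
    then show ?thesis by (simp add: cnj_fourier_mode mult_ac)
  qed
  ultimately have "((\<lambda>(n, j). fourier_mode n y * (w l j * cnj (w l (j + n)))) has_sum row l y * cnj (row l y)) (UNIV \<times> UNIV)"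
    by (simp only: eq)
  then have "((\<lambda>n. fourier_mode n y * row_corr l n) has_sum row l y * cnj (row l y)) UNIV"
    by (rule has_sum_SigmaD) (auto intro!: has_sum_cmult_right row_corr_has_sum)
  then show ?thesis by (simp only: complex_norm_square)
qed

lemma correlation_mean_eq:
  assumes "finite I"
  shows "correlation_mean W 0 n I = (1 / of_nat (card I)) * (\<Sum>l\<in>I. row_corr l n)"
  unfolding correlation_mean_def
  using infsumI[OF has_sum_times_finite[OF assms row_corr_has_sum]] by simp

lemma average_trace_eq:
  "average_trace W = Limsup long_intervals (\<lambda>I. ereal ((1 / real (card I)) * (\<Sum>l\<in>I. (L2_norm (row l))\<^sup>2)))"
  unfolding average_trace_def
proof (rule Limsup_eq)
  have "eventually (\<lambda>I. finite I) long_intervals"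
    unfolding eventually_long_intervals by auto
  then show "\<forall>\<^sub>F I in long_intervals.
      ereal ((1 / real (card I)) * (\<Sum>\<^sub>\<infinity>(j, l)\<in>UNIV \<times> I. (cmod (mat_entry W l j))\<^sup>2)) =
      ereal ((1 / real (card I)) * (\<Sum>l\<in>I. (L2_norm (row l))\<^sup>2))"
    by eventually_elim (simp add: infsumI[OF has_sum_times_finite[OF _ row_norm_has_sum]])
qed

text \<open>
  Uniformity in \<open>y\<close> and in the position of the window: frequencies beyond \<open>M\<close> are negligible for
  every single row by the majorant, and for the finitely many others the window averages of the
  correlations converge.
\<close>

lemma row_average_uniform_le:
  assumes \<omega>: "\<And>n. (correlation_mean W 0 n \<longlongrightarrow> \<omega> n) long_intervals" and "\<epsilon> > 0"
  obtains M N :: nat where "N > 0"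
    "\<And>m y. (\<Sum>r<N. (cmod (row (m - int r) y))\<^sup>2)
      \<le> real N * ((\<Sum>n\<in>{- int M..int M}. Re (fourier_mode n y * \<omega> n)) + \<epsilon>)"
proof -
  have "\<epsilon> / 2 > 0" using \<open>\<epsilon> > 0\<close> by simp
  then obtain M :: nat where M: "\<And>G. finite G \<Longrightarrow> (\<And>n. n \<in> G \<Longrightarrow> \<bar>n\<bar> > int M) \<Longrightarrow> sum c_conv G < \<epsilon> / 2"
    using summable_on_int_tail_small[OF c_conv_summable c_conv_nonneg] by blast
  let ?F = "{- int M..int M}"
  \<comment> \<open>the \<open>2 M + 1\<close> retained frequencies share an error of \<open>\<epsilon> / 2\<close>\<close>
  define \<delta> where "\<delta> = \<epsilon> / (2 * (2 * real M + 1))"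
  have \<delta>: "\<delta> > 0" "(2 * real M + 1) * \<delta> = \<epsilon> / 2"
    using \<open>\<epsilon> > 0\<close> by (auto simp: \<delta>_def field_simps)
  have "\<forall>\<^sub>F I in long_intervals. \<forall>n\<in>?F. dist (correlation_mean W 0 n I) (\<omega> n) < \<delta>"
    by (intro eventually_ball_finite ballI tendstoD[OF \<omega> \<delta>(1)]) simp
  then obtain N0 where N0: "\<And>a b n. N0 \<le> card {a..b} \<Longrightarrow> n \<in> ?F \<Longrightarrow> dist (correlation_mean W 0 n {a..b}) (\<omega> n) < \<delta>"
    unfolding eventually_long_intervals by blast
  have trunc: "(cmod (row l y))\<^sup>2 \<le> (\<Sum>n\<in>?F. Re (fourier_mode n y * row_corr l n)) + \<epsilon> / 2" for l y
  proof -
    let ?t = "\<lambda>n. Re (fourier_mode n y * row_corr l n)"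
    have "(?t has_sum (cmod (row l y))\<^sup>2) UNIV"
      using has_sum_Re[OF row_norm_sq_has_sum_corr[of y l]] by simp
    moreover have "(?t has_sum sum ?t ?F) ?F" by (rule has_sum_finite) simp
    ultimately have "(?t has_sum ((cmod (row l y))\<^sup>2 - sum ?t ?F)) (UNIV - ?F)"
      by (rule has_sum_Diff) simp
    then have "(cmod (row l y))\<^sup>2 - sum ?t ?F \<le> \<epsilon> / 2"
    proof (rule has_sum_le_finite_sums)
      fix G assume G: "finite G" "G \<subseteq> UNIV - ?F"
      have "sum ?t G \<le> sum c_conv G"
      proof (rule sum_mono)
        fix n
        have "?t n \<le> cmod (fourier_mode n y * row_corr l n)" by (rule complex_Re_le_cmod)
        then show "?t n \<le> c_conv n" using norm_row_corr_le[of l n] by (simp add: norm_mult)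
      qed
      also have "sum c_conv G < \<epsilon> / 2"
      proof (rule M)
        fix n assume "n \<in> G"
        then have "n \<notin> ?F" using G by blast
        then show "\<bar>n\<bar> > int M" by auto
      qed (use G in simp)
      finally show "sum ?t G \<le> \<epsilon> / 2" by simp
    qed
    then show ?thesis by simp
  qed
  define N where "N = max N0 1"
  have N: "N > 0" by (simp add: N_def)
  show thesis
  proof (rule that[OF N])
    fix m y
    let ?I = "{m - int N + 1..m}"
    have card: "card ?I = N" by simp
    have bij: "(\<Sum>l\<in>?I. g l) = (\<Sum>r<N. g (m - int r))" for g :: "int \<Rightarrow> real"
      by (rule sum.reindex_bij_witness[of _ "\<lambda>r. m - int r" "\<lambda>l. nat (m - l)"]) auto
    have "(\<Sum>r<N. (cmod (row (m - int r) y))\<^sup>2)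
        \<le> (\<Sum>l\<in>?I. (\<Sum>n\<in>?F. Re (fourier_mode n y * row_corr l n)) + \<epsilon> / 2)"
      unfolding bij[of "\<lambda>l. (cmod (row l y))\<^sup>2", symmetric] by (rule sum_mono) (rule trunc)
    also have "\<dots> = (\<Sum>n\<in>?F. \<Sum>l\<in>?I. Re (fourier_mode n y * row_corr l n)) + real N * (\<epsilon> / 2)"
      by (subst sum.distrib, subst sum.swap) simp
    also have "(\<Sum>n\<in>?F. \<Sum>l\<in>?I. Re (fourier_mode n y * row_corr l n))
        \<le> (\<Sum>n\<in>?F. real N * (Re (fourier_mode n y * \<omega> n) + \<delta>))"
    proof (rule sum_mono)
      fix n assume n: "n \<in> ?F"
      have "(\<Sum>l\<in>?I. Re (fourier_mode n y * row_corr l n)) = Re (fourier_mode n y * (\<Sum>l\<in>?I. row_corr l n))"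
        by (simp only: sum_distrib_left Re_sum)
      also have "(\<Sum>l\<in>?I. row_corr l n) = of_nat N * correlation_mean W 0 n ?I"
        using N unfolding correlation_mean_eq[OF finite_atLeastAtMost_int] card by simp
      also have "fourier_mode n y * (of_nat N * correlation_mean W 0 n ?I)
          = of_real (real N) * (fourier_mode n y * \<omega> n + fourier_mode n y * (correlation_mean W 0 n ?I - \<omega> n))"
        by (simp add: algebra_simps)
      also have "Re \<dots> = real N * (Re (fourier_mode n y * \<omega> n) + Re (fourier_mode n y * (correlation_mean W 0 n ?I - \<omega> n)))"
      proof -
        have "Re (of_real a * (u + v)) = a * (Re u + Re v)" for a u v by (simp add: distrib_left)
        then show ?thesis .
      qed
      also have "\<dots> \<le> real N * (Re (fourier_mode n y * \<omega> n) + \<delta>)"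
      proof (intro mult_left_mono add_left_mono)
        have "Re (fourier_mode n y * (correlation_mean W 0 n ?I - \<omega> n))
            \<le> cmod (fourier_mode n y * (correlation_mean W 0 n ?I - \<omega> n))" by (rule complex_Re_le_cmod)
        also have "\<dots> = dist (correlation_mean W 0 n ?I) (\<omega> n)" by (simp add: norm_mult dist_norm)
        also have "\<dots> \<le> \<delta>"
          by (rule less_imp_le, rule N0) (use card n in \<open>simp_all add: N_def\<close>)
        finally show "Re (fourier_mode n y * (correlation_mean W 0 n ?I - \<omega> n)) \<le> \<delta>" .
      qed simp
      finally show "(\<Sum>l\<in>?I. Re (fourier_mode n y * row_corr l n)) \<le> real N * (Re (fourier_mode n y * \<omega> n) + \<delta>)" .
    qed
    also have "(\<Sum>n\<in>?F. real N * (Re (fourier_mode n y * \<omega> n) + \<delta>)) =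
        real N * ((\<Sum>n\<in>?F. Re (fourier_mode n y * \<omega> n)) + (2 * real M + 1) * \<delta>)"
    proof -
      have "real (card ?F) = 2 * real M + 1" by simp
      then show ?thesis by (simp only: sum_distrib_left[symmetric] sum.distrib sum_constant)
    qed
    finally show "(\<Sum>r<N. (cmod (row (m - int r) y))\<^sup>2)
      \<le> real N * ((\<Sum>n\<in>?F. Re (fourier_mode n y * \<omega> n)) + \<epsilon>)"
      unfolding \<delta>(2) by (simp add: algebra_simps)
  qed
qed

end

section \<open>Equidistant partitions\<close>

definition equal_arc :: "nat \<Rightarrow> nat \<Rightarrow> real set" where
  "equal_arc K i = {2 * pi * (real i - 1) / real K..<2 * pi * real i / real K}"

text \<open>
  The values of the mode are the powers of a \<open>K\<close>-th root of unity, which differs from \<open>1\<close> because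
  \<open>K\<close> does not divide \<open>n\<close>.
\<close>

lemma sum_fourier_mode_equidistant:
  assumes "0 < K" "\<bar>n\<bar> < int K"
  shows "(\<Sum>i=1..K. fourier_mode n (2 * pi * real i / real K)) = (if n = 0 then of_nat K else 0)"
proof (cases "n = 0")
  case False
  define z where "z = cis (2 * pi * of_int n / real K)"
  have pow: "fourier_mode n (2 * pi * real i / real K) = z ^ i" for i
  proof -
    have "of_int n * (2 * pi * real i / real K) = real i * (2 * pi * of_int n / real K)" by simp
    then show ?thesis unfolding fourier_mode_cis z_def by (simp only: Complex.DeMoivre)
  qed
  have "z ^ K = 1"
    unfolding z_def Complex.DeMoivre using assms(1) cis_multiple_2pi[of "of_int n"] by simp
  moreover have "z \<noteq> 1"
  proof
    assume "z = 1"
    then have "cos (2 * pi * of_int n / real K) = 1" unfolding z_def by (simp add: complex_eq_iff)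
    then obtain k :: int where "2 * pi * of_int n / real K = of_int k * 2 * pi"
      unfolding cos_one_2pi_int by blast
    then have "real_of_int n = of_int k * real K" using assms(1) by (simp add: field_simps)
    then have "real_of_int n = real_of_int (k * int K)" by simp
    then have "n = k * int K" by (simp only: of_int_eq_iff)
    with False assms(2) show False
      by (metis abs_mult abs_of_nat dvd_imp_le_int dvd_triv_right linorder_not_le)
  qed
  ultimately have "(\<Sum>i<K. z ^ i) = 0"
    using geometric_sum[of z K] by simp
  moreover have "(\<Sum>i=1..K. z ^ i) = z * (\<Sum>i<K. z ^ i)"
    unfolding sum_distrib_left
    by (rule sum.reindex_bij_witness[of _ Suc "\<lambda>i. i - 1"]) (auto simp flip: power_Suc)
  ultimately show ?thesis unfolding pow using False by simp
qed simp

lemma arc_partition: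
  assumes K: "0 < K"
  shows "torus_partition K (equal_arc K)"
    and "\<And>i. i \<in> {1..K} \<Longrightarrow> equal_arc K i \<in> sets torus"
    and "\<And>i. i \<in> {1..K} \<Longrightarrow> measure torus (equal_arc K i) = 1 / real K"
proof -
  have range: "0 \<le> 2 * pi * (real i - 1) / real K" "2 * pi * (real i - 1) / real K \<le> 2 * pi * real i / real K"
    "2 * pi * real i / real K \<le> 2 * pi" if "i \<in> {1..K}" for i
    using that K by (auto simp: field_simps)
  have sub: "equal_arc K i \<subseteq> {0..<2*pi}" if "i \<in> {1..K}" for i
    using range[OF that] by (auto simp: equal_arc_def)
  show s: "equal_arc K i \<in> sets torus" if "i \<in> {1..K}" for i
  proof -
    have "equal_arc K i \<in> sets borel" by (simp add: equal_arc_def)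
    from in_sets_torusI[OF this] show ?thesis unfolding Int_absorb2[OF sub[OF that]] .
  qed
  show "measure torus (equal_arc K i) = 1 / real K" if "i \<in> {1..K}" for i
    unfolding equal_arc_def measure_def emeasure_torus_Ico[OF range[OF that]]
    using K by (simp add: field_simps)
  have arc_iff: "x \<in> equal_arc K i \<longleftrightarrow> real i - 1 \<le> x * real K / (2 * pi) \<and> x * real K / (2 * pi) < real i" for x i
    using K by (simp add: equal_arc_def field_simps)
  show "torus_partition K (equal_arc K)"
    unfolding torus_partition_def
  proof (intro conjI ballI impI s)
    fix i j assume ij: "i \<in> {1..K}" "j \<in> {1..K}" "i \<noteq> j"
    have "equal_arc K i \<inter> equal_arc K j = {}"
    proof (rule ccontr)
      assume "equal_arc K i \<inter> equal_arc K j \<noteq> {}"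
      then obtain x where "x \<in> equal_arc K i" "x \<in> equal_arc K j" by blast
      then have "real i - 1 < real j" "real j - 1 < real i" unfolding arc_iff by linarith+
      then show False using ij(3) by linarith
    qed
    then show "equal_arc K i \<inter> equal_arc K j \<in> null_sets torus" by simp
  next
    have "space torus \<subseteq> (\<Union>i\<in>{1..K}. equal_arc K i)"
    proof
      fix x assume "x \<in> space torus"
      then have x: "0 \<le> x" "x < 2 * pi" by auto
      define t where "t = x * real K / (2 * pi)"
      have t: "0 \<le> t" "t < real K" using x K by (auto simp: t_def field_simps)
      define i where "i = nat \<lfloor>t\<rfloor> + 1"
      have "real i - 1 \<le> t" "t < real i" "i \<in> {1..K}" unfolding i_def using t by (auto simp: le_nat_iff) linarith+
      then show "x \<in> (\<Union>i\<in>{1..K}. equal_arc K i)" using arc_iff[of x i] by (auto simp: t_def)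
    qed
    then have "space torus - (\<Union>i\<in>{1..K}. equal_arc K i) = {}" by blast
    moreover have "{} \<in> null_sets torus" by simp
    ultimately show "space torus - (\<Union>i\<in>{1..K}. equal_arc K i) \<in> null_sets torus" by (simp only:)
  qed auto
qed

context diagonal_type_operator
begin

text \<open>
  With more arcs than the largest frequency, the mean of the trigonometric polynomial over their end
  points is exactly its constant term; still more arcs make the freezing error small. The window length \<open>N\<close>
  must be fixed first because the freezing error depends on it.
\<close>

lemma arc_partition_upper_bound:
  assumes \<omega>: "\<And>n. (correlation_mean W 0 n \<longlongrightarrow> \<omega> n) long_intervals" and \<epsilon>: "\<epsilon> > 0"
  shows "\<exists>K Y. torus_partition K Y \<and>
    (\<Sum>i=1..K. measure torus (Y i) * (op_norm (W \<circ> cutoff (Y i)))\<^sup>2) \<le> (1 + \<epsilon>) * (Re (\<omega> 0) + \<epsilon>) + \<epsilon>"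
proof -
  obtain M N :: nat where N: "N > 0" and avg: "\<And>m y. (\<Sum>r<N. (cmod (row (m - int r) y))\<^sup>2)
      \<le> real N * ((\<Sum>n\<in>{- int M..int M}. Re (fourier_mode n y * \<omega> n)) + \<epsilon>)"
    by (rule row_average_uniform_le[OF \<omega> \<epsilon>]) (rule that)
  define P where "P y = (\<Sum>n\<in>{- int M..int M}. Re (fourier_mode n y * \<omega> n))" for y
  have "(\<lambda>K. (1 + 1 / \<epsilon>) * freezing_error (real N) (2 * pi / real K)) \<longlonglongrightarrow> 0"
    by (intro tendsto_mult_right_zero freezing_error_tendsto_0) simp
  then have "\<forall>\<^sub>F K in sequentially. (1 + 1 / \<epsilon>) * freezing_error (real N) (2 * pi / real K) < \<epsilon>"
    by (rule order_tendstoD(2)) (rule \<epsilon>)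
  then have "\<forall>\<^sub>F K in sequentially. (1 + 1 / \<epsilon>) * freezing_error (real N) (2 * pi / real K) < \<epsilon> \<and> M < K"
    using eventually_gt_at_top by (rule eventually_conj)
  then obtain K where K: "(1 + 1 / \<epsilon>) * freezing_error (real N) (2 * pi / real K) < \<epsilon>" "M < K"
    by (auto simp: eventually_sequentially)
  then have K0: "0 < K" by simp
  define y where "y i = 2 * pi * real i / real K" for i
  have local: "(op_norm (W \<circ> cutoff (equal_arc K i)))\<^sup>2 \<le> (1 + \<epsilon>) * (P (y i) + \<epsilon>) + \<epsilon>" if i: "i \<in> {1..K}" for i
  proof (rule op_norm_cutoff_sq_le)
    show s: "equal_arc K i \<in> sets torus" by (rule arc_partition(2)[OF K0 i])
    fix f assume f: "f \<in> L2_torus" "L2_norm f \<le> 1"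
    have "L2_norm (cutoff (equal_arc K i) f) \<le> L2_norm f"
      by (rule power2_le_imp_le[OF L2_norm_cutoff_sq_le[OF s f(1)] L2_norm_nonneg])
    then have n: "L2_norm (cutoff (equal_arc K i) f) \<le> 1" using f(2) by simp
    have supp: "\<bar>x - y i\<bar> \<le> 2 * pi / real K" if "cutoff (equal_arc K i) f x \<noteq> 0" for x
    proof -
      have "x \<in> equal_arc K i" using that by (auto simp: cutoff_def split: split_indicator_asm)
      moreover have "2 * pi * (real i - 1) / real K = y i - 2 * pi / real K"
        by (simp add: y_def right_diff_distrib diff_divide_distrib)
      moreover have "0 \<le> 2 * pi / real K" by simp
      ultimately show ?thesis unfolding equal_arc_def y_def[symmetric] by auto
    qed
    have "(L2_norm (W (cutoff (equal_arc K i) f)))\<^sup>2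
        \<le> (1 + \<epsilon>) * (P (y i) + \<epsilon>) + (1 + 1 / \<epsilon>) * freezing_error (real N) (2 * pi / real K)"
      by (rule local_upper_bound[OF cutoff_L2[OF s f(1)] n supp N avg[folded P_def] \<epsilon>])
    then show "(L2_norm (W (cutoff (equal_arc K i) f)))\<^sup>2 \<le> (1 + \<epsilon>) * (P (y i) + \<epsilon>) + \<epsilon>"
      using K(1) by linarith
  qed
  have mean: "(\<Sum>i=1..K. P (y i)) = real K * Re (\<omega> 0)"
  proof -
    have "(\<Sum>i=1..K. P (y i)) = (\<Sum>n\<in>{- int M..int M}. Re ((\<Sum>i=1..K. fourier_mode n (y i)) * \<omega> n))"
      unfolding P_def by (subst sum.swap) (simp only: sum_distrib_right Re_sum)
    also have "\<dots> = (\<Sum>n\<in>{- int M..int M}. if n = 0 then real K * Re (\<omega> 0) else 0)"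
      unfolding y_def
      by (rule sum.cong[OF refl], subst sum_fourier_mode_equidistant[OF K0]) (use K(2) in auto)
    also have "\<dots> = real K * Re (\<omega> 0)" by simp
    finally show ?thesis .
  qed
  have "(\<Sum>i=1..K. measure torus (equal_arc K i) * (op_norm (W \<circ> cutoff (equal_arc K i)))\<^sup>2)
      \<le> (\<Sum>i=1..K. 1 / real K * ((1 + \<epsilon>) * (P (y i) + \<epsilon>) + \<epsilon>))"
    by (intro sum_mono) (simp add: arc_partition(3)[OF K0] mult_left_mono divide_right_mono local)
  also have "\<dots> = 1 / real K * ((1 + \<epsilon>) * ((\<Sum>i=1..K. P (y i)) + real K * \<epsilon>) + real K * \<epsilon>)"
    unfolding sum_distrib_left[symmetric] sum.distrib by simp
  also have "\<dots> = (1 + \<epsilon>) * (Re (\<omega> 0) + \<epsilon>) + \<epsilon>"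
    unfolding mean using K0 by (simp add: field_simps)
  finally show ?thesis using arc_partition(1)[OF K0] by blast
qed

end

theorem lemma4p3:
  fixes W :: operator
  assumes "W \<in> regular_operators"
  shows "ereal ((mu_norm W)\<^sup>2) = average_trace W"
proof -
  interpret diagonal_type_operator W
    by unfold_locales (use assms in \<open>simp add: regular_operators_def\<close>)
  have "\<forall>n. \<exists>\<omega>. (correlation_mean W 0 n \<longlongrightarrow> \<omega>) long_intervals"
    using assms unfolding regular_operators_def by blast
  from choice[OF this] obtain \<omega> where \<omega>: "\<And>n. (correlation_mean W 0 n \<longlongrightarrow> \<omega> n) long_intervals"
    by blast
  define \<tau> where "\<tau> = Re (\<omega> 0)"
  let ?A = "\<lambda>I. (1 / real (card I)) * (\<Sum>l\<in>I. (L2_norm (row l))\<^sup>2)"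
  have "((\<lambda>I. Re (correlation_mean W 0 0 I)) \<longlongrightarrow> \<tau>) long_intervals"
    unfolding \<tau>_def by (intro tendsto_Re \<omega>)
  moreover have "\<forall>\<^sub>F I in long_intervals. Re (correlation_mean W 0 0 I) = ?A I"
  proof -
    have "Re (correlation_mean W 0 0 I) = ?A I" if "finite I" for I
    proof -
      have "correlation_mean W 0 0 I = of_real (?A I)"
        unfolding correlation_mean_eq[OF that] row_corr_0 by simp
      then show ?thesis by (simp only: Re_complex_of_real)
    qed
    then show ?thesis unfolding eventually_long_intervals by blast
  qed
  ultimately have lim: "(?A \<longlongrightarrow> \<tau>) long_intervals"
    by (rule Lim_transform_eventually)
  have trace: "average_trace W = ereal \<tau>"
    unfolding average_trace_eq
    by (rule lim_imp_Limsup[OF long_intervals_neq_bot]) (intro tendsto_ereal lim)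
  let ?S = "{(\<Sum>i=1..K. measure torus (Y i) * (op_norm (W \<circ> cutoff (Y i)))\<^sup>2) | K Y. torus_partition K Y}"
  have lower: "\<tau> \<le> s" if s: "s \<in> ?S" for s
  proof (rule field_le_epsilon)
    fix e :: real assume "e > 0"
    obtain K Y where KY: "torus_partition K Y"
      "s = (\<Sum>i=1..K. measure torus (Y i) * (op_norm (W \<circ> cutoff (Y i)))\<^sup>2)"
      using s by blast
    show "\<tau> \<le> s + e"
      using partition_lower_bound[OF KY(1) \<open>e > 0\<close>] unfolding KY(2)
      by (rule tendsto_upperbound[OF lim _ long_intervals_neq_bot])
  qed
  have bdd: "bdd_below ?S" by (rule bdd_belowI[of _ \<tau>]) (rule lower)
  have upper: "Inf ?S \<le> (1 + e) * (\<tau> + e) + e" if e: "e > 0" for e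
  proof -
    obtain K Y where KY: "torus_partition K Y"
      "(\<Sum>i=1..K. measure torus (Y i) * (op_norm (W \<circ> cutoff (Y i)))\<^sup>2) \<le> (1 + e) * (\<tau> + e) + e"
      using arc_partition_upper_bound[OF \<omega> e] unfolding \<tau>_def by blast
    have "Inf ?S \<le> (\<Sum>i=1..K. measure torus (Y i) * (op_norm (W \<circ> cutoff (Y i)))\<^sup>2)"
      by (rule cInf_lower[OF _ bdd]) (use KY(1) in blast)
    with KY(2) show ?thesis by linarith
  qed
  \<comment> \<open>letting the error in the upper bound tend to zero\<close>
  have "Inf ?S \<le> \<tau>"
  proof (rule tendsto_lowerbound)
    have "((\<lambda>e. (1 + e) * (\<tau> + e) + e) \<longlongrightarrow> (1 + 0) * (\<tau> + 0) + 0) (at_right 0)"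
      by (intro tendsto_intros)
    then show "((\<lambda>e. (1 + e) * (\<tau> + e) + e) \<longlongrightarrow> \<tau>) (at_right 0)" by simp
    show "\<forall>\<^sub>F e in at_right 0. Inf ?S \<le> (1 + e) * (\<tau> + e) + e"
      using upper by (auto intro: eventually_at_rightI[of 0 1])
  qed simp
  moreover have "\<tau> \<le> Inf ?S"
  proof (rule cInf_greatest[OF _ lower])
    have "torus_partition 1 (equal_arc 1)" by (rule arc_partition) simp
    then have "(\<Sum>i=1..1. measure torus (equal_arc 1 i) * (op_norm (W \<circ> cutoff (equal_arc 1 i)))\<^sup>2) \<in> ?S"
      by (intro CollectI exI[of _ 1] exI[of _ "equal_arc 1"] conjI refl)
    then show "?S \<noteq> {}" by (metis empty_iff)
  qed
  moreover have "0 \<le> \<tau>"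
  proof (rule tendsto_lowerbound[OF lim always_eventually long_intervals_neq_bot], rule allI)
    show "0 \<le> ?A I" for I by (intro mult_nonneg_nonneg sum_nonneg) auto
  qed
  ultimately have "(mu_norm W)\<^sup>2 = \<tau>" unfolding mu_norm_def by simp
  with trace show ?thesis by simp
qed

end
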